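(* Let $F\in C^2(\mathbb{R})$ satisfy $0=F(0)=\min_{\mathbb{R}}F$. For any $q>0$ such that \[ 4F''(0)<q^2<2\liminf_{|t|\to+\infty}\frac{F(t)}{t^2}, \] there exists a nontrivial periodic solution $u:\mathbb{R}\to\mathbb{R}$ to \[ u''''+qu''+F'(u)=0 . \]
   Context: A solution is a $C^4$ function $u:\mathbb{R}\to\mathbb{R}$ satisfying the equation at every point of $\mathbb{R}$. A solution is called nontrivial if it is non-constant. The $\liminf$ is allowed to be $+\infty$. *)

theory Defs
  imports "HOL-Analysis.Analysis" "HOL-Library.Periodic_Fun"
begin

(* The differentiability clause is needed because deriv is total: it has an
   unspecified value at points where the function is not differentiable. *)
definition C_k :: "nat \<Rightarrow> (real \<Rightarrow> real) \<Rightarrow> bool" where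
  "C_k k f \<longleftrightarrow>
     (\<forall>j<k. \<forall>x. (deriv ^^ j) f differentiable (at x)) \<and>
     continuous_on UNIV ((deriv ^^ k) f)"

definition is_solution :: "(real \<Rightarrow> real) \<Rightarrow> real \<Rightarrow> (real \<Rightarrow> real) \<Rightarrow> bool" where
  "is_solution F q u \<longleftrightarrow>
     C_k 4 u \<and>
     (\<forall>x. (deriv ^^ 4) u x + q * (deriv ^^ 2) u x + deriv F (u x) = 0)"

definition nontrivial :: "(real \<Rightarrow> real) \<Rightarrow> bool" where
  "nontrivial u \<longleftrightarrow> \<not> u constant_on UNIV"

definition periodic :: "(real \<Rightarrow> real) \<Rightarrow> bool" where
  "periodic u \<longleftrightarrow> (\<exists>T>0. periodic_fun_simple u T)"

end

theory Submission
  imports Defs "HOL-Complex_Analysis.Great_Picard"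
begin

text \<open>Fix the period \<open>T = 2 \<pi> / sqrt (q / 2)\<close>, at whose basic frequency the symbol
  \<open>\<xi>\<^sup>4 - q \<xi>\<^sup>2\<close> attains its minimum \<open>- q\<^sup>2 / 4\<close>. Since \<open>4 F''(0) < q\<^sup>2\<close>, a small cosine of period \<open>T\<close>
  has negative energy \<open>\<integral> u''\<^sup>2 / 2 - q u'\<^sup>2 / 2 + F(u)\<close>, whereas constants have nonnegative
  energy, so it is enough to find a \<open>T\<close>-periodic solution whose energy is at most that of the cosine.
  The growth of \<open>F\<close> makes the energy coercive and bounds every function of negative energy by
  some \<open>M\<close>; hence \<open>F\<close> may be changed outside \<open>[-M, M]\<close> so that its derivative \<open>g\<close> becomes globally
  Lipschitz. Instead of minimising in a Sobolev space, one runs semi-implicit gradient descent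
  \<open>w'''' + q w'' + a w = a u - g(u)\<close> from the cosine: for large \<open>a\<close> this linear equation is uniquely
  solvable among periodic functions, and the energy drops by at least \<open>\<integral> (w - u)\<^sup>2\<close> in each step. The
  iterates are bounded and equicontinuous, so a subsequence converges uniformly, and its limit is a
  fixed point of the iteration.\<close>

section \<open>Periodic functions with their derivatives, and the energy\<close>

text \<open>A \<open>C^4\<close> function is carried together with its derivatives
  \<open>U 0\<close>, ..., \<open>U 4\<close>, so that differentiating means raising an index;
  entries beyond 4 are arbitrary. Periodicity of the derivatives follows from that of
  \<open>U 0\<close>.\<close>

definition periodic_chain :: "real \<Rightarrow> (nat \<Rightarrow> real \<Rightarrow> real) \<Rightarrow> bool" where
  "periodic_chain T U \<longleftrightarrow>
     (\<forall>j<4. \<forall>x. (U j has_real_derivative U (Suc j) x) (at x)) \<and>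
     continuous_on UNIV (U 4) \<and> (\<forall>x. U 0 (x + T) = U 0 x)"

text \<open>The action over one period: its Euler-Lagrange equation is
  \<open>u'''' + q u'' + G'(u) = 0\<close>.\<close>

definition energy :: "real \<Rightarrow> real \<Rightarrow> (real \<Rightarrow> real) \<Rightarrow> (nat \<Rightarrow> real \<Rightarrow> real) \<Rightarrow> real" where
  "energy T q G U = integral {0..T} (\<lambda>x. (U 2 x)\<^sup>2 / 2 - q / 2 * (U 1 x)\<^sup>2 + G (U 0 x))"

lemma periodic_chainI:
  assumes "\<And>x. (U 0 has_real_derivative U 1 x) (at x)"
    and "\<And>x. (U 1 has_real_derivative U 2 x) (at x)"
    and "\<And>x. (U 2 has_real_derivative U 3 x) (at x)"
    and "\<And>x. (U 3 has_real_derivative U 4 x) (at x)"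
    and "continuous_on UNIV (U 4)" and "\<And>x. U 0 (x + T) = U 0 x"
  shows "periodic_chain T U"
proof -
  have "(U j has_real_derivative U (Suc j) x) (at x)" if "j < 4" for j x
  proof -
    from that have "j = 0 \<or> j = 1 \<or> j = 2 \<or> j = 3" by auto
    then show ?thesis
      using assms(1-4)[of x] by (auto simp: numeral_eq_Suc)
  qed
  then show ?thesis using assms(5,6) by (simp add: periodic_chain_def)
qed

lemma periodic_chain_deriv:
  assumes "periodic_chain T U"
  shows "\<And>x. (U 0 has_real_derivative U 1 x) (at x)"
    and "\<And>x. (U 1 has_real_derivative U 2 x) (at x)"
    and "\<And>x. (U 2 has_real_derivative U 3 x) (at x)"
    and "\<And>x. (U 3 has_real_derivative U 4 x) (at x)"
proof -
  have *: "(U j has_real_derivative U (Suc j) x) (at x)" if "j < 4" for j x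
    using assms that by (simp add: periodic_chain_def)
  show "(U 0 has_real_derivative U 1 x) (at x)" for x using *[of 0] by simp
  show "(U 1 has_real_derivative U 2 x) (at x)" for x using *[of 1] by (simp add: numeral_eq_Suc)
  show "(U 2 has_real_derivative U 3 x) (at x)" for x using *[of 2] by (simp add: numeral_eq_Suc)
  show "(U 3 has_real_derivative U 4 x) (at x)" for x using *[of 3] by (simp add: numeral_eq_Suc)
qed

lemma has_real_derivative_imp_continuous_on:
  fixes f :: "real \<Rightarrow> real"
  assumes "\<And>x. (f has_real_derivative f' x) (at x)"
  shows "continuous_on S f"
  using assms by (intro continuous_at_imp_continuous_on ballI DERIV_isCont)

lemma periodic_chain_continuous:
  assumes "periodic_chain T U" and "j \<le> 4"
  shows "continuous_on S (U j)"
proof (cases "j = 4")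
  case True
  then show ?thesis
    using assms(1) continuous_on_subset[of UNIV "U 4" S] by (simp add: periodic_chain_def)
next
  case False
  with assms have "\<And>x. (U j has_real_derivative U (Suc j) x) (at x)"
    by (simp add: periodic_chain_def)
  then show ?thesis by (rule has_real_derivative_imp_continuous_on)
qed

lemma has_real_derivative_periodic:
  fixes f f' :: "real \<Rightarrow> real"
  assumes "\<And>x. (f has_real_derivative f' x) (at x)" and "\<And>x. f (x + T) = f x"
  shows "f' (x + T) = f' x"
proof -
  have "((\<lambda>x. f (x + T)) has_real_derivative f' (x + T)) (at x)"
    using assms(1)[of "x + T"] by (simp add: DERIV_shift)
  then have "(f has_real_derivative f' (x + T)) (at x)" by (simp add: assms(2))
  then show ?thesis using assms(1) DERIV_unique by blast
qed

lemma periodic_chain_periodic: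
  assumes "periodic_chain T U" and "j \<le> 4"
  shows "U j (x + T) = U j x"
  using assms(2)
proof (induction j arbitrary: x)
  case 0
  then show ?case using assms by (simp add: periodic_chain_def)
next
  case (Suc j)
  have "\<And>x. (U j has_real_derivative U (Suc j) x) (at x)"
    using assms(1) Suc.prems by (simp add: periodic_chain_def)
  then show ?case using Suc by (auto intro: has_real_derivative_periodic)
qed

lemma periodic_chain_diff:
  assumes "periodic_chain T U" and "periodic_chain T V"
  shows "periodic_chain T (\<lambda>j x. U j x - V j x)"
  using assms unfolding periodic_chain_def
  by (auto intro!: DERIV_diff continuous_on_diff)

section \<open>Integration over a period and sup bounds\<close>

lemma integral_real_mono:
  fixes f g :: "real \<Rightarrow> real"
  assumes "continuous_on {a..b} f" and "continuous_on {a..b} g" and "\<And>x. x \<in> {a..b} \<Longrightarrow> f x \<le> g x"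
  shows "integral {a..b} f \<le> integral {a..b} g"
  by (rule integral_le) (use assms in \<open>auto intro: integrable_continuous_real\<close>)

lemma integral_by_parts_periodic:
  fixes f g :: "real \<Rightarrow> real"
  assumes "T > 0"
    and "\<And>x. (f has_real_derivative f' x) (at x)" and "\<And>x. (g has_real_derivative g' x) (at x)"
    and "continuous_on UNIV f'" and "continuous_on UNIV g'"
    and "f T = f 0" and "g T = g 0"
  shows "integral {0..T} (\<lambda>x. f' x * g x) = - integral {0..T} (\<lambda>x. f x * g' x)"
proof -
  have cf: "continuous_on S f" for S using assms(2) by (rule has_real_derivative_imp_continuous_on)
  have cg: "continuous_on S g" for S using assms(3) by (rule has_real_derivative_imp_continuous_on)
  have cf': "continuous_on S f'" and cg': "continuous_on S g'" for S
    using assms(4,5) continuous_on_subset by blast+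
  have "((\<lambda>x. f' x * g x + f x * g' x) has_integral (f T * g T - f 0 * g 0)) {0..T}"
  proof (rule fundamental_theorem_of_calculus)
    show "((\<lambda>x. f x * g x) has_vector_derivative f' x * g x + f x * g' x) (at x within {0..T})" for x
      unfolding has_real_derivative_iff_has_vector_derivative[symmetric]
      by (rule has_field_derivative_at_within)
        (auto intro!: derivative_eq_intros assms(2,3))
  qed (use assms in simp)
  then have "integral {0..T} (\<lambda>x. f' x * g x + f x * g' x) = 0"
    using assms by (simp add: integral_unique)
  moreover have "integral {0..T} (\<lambda>x. f' x * g x + f x * g' x)
     = integral {0..T} (\<lambda>x. f' x * g x) + integral {0..T} (\<lambda>x. f x * g' x)"
    by (intro integral_add integrable_continuous_real continuous_intros cf cg cf' cg')
  ultimately show ?thesis by linarith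
qed

text \<open>Boundary terms cancel by periodicity. No derivative of \<open>V\<close> is left on the
  right, so first variations become integrals of products with \<open>V 0\<close>.\<close>

lemma periodic_chain_by_parts:
  assumes "T > 0" and "periodic_chain T U" and "periodic_chain T V"
  shows "integral {0..T} (\<lambda>x. U 1 x * V 1 x) = - integral {0..T} (\<lambda>x. U 2 x * V 0 x)"
    and "integral {0..T} (\<lambda>x. U 2 x * V 2 x) = integral {0..T} (\<lambda>x. U 4 x * V 0 x)"
proof -
  note D = periodic_chain_deriv[OF assms(2)] periodic_chain_deriv[OF assms(3)]
  note C = periodic_chain_continuous[OF assms(2)] periodic_chain_continuous[OF assms(3)]
  have P: "U j T = U j 0" "V j T = V j 0" if "j \<le> 4" for j
    using periodic_chain_periodic[OF assms(2) that, of 0] periodic_chain_periodic[OF assms(3) that, of 0]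
    by simp_all
  have "integral {0..T} (\<lambda>x. U 2 x * V 0 x) = - integral {0..T} (\<lambda>x. U 1 x * V 1 x)"
    by (rule integral_by_parts_periodic) (use D C P assms(1) in auto)
  then show "integral {0..T} (\<lambda>x. U 1 x * V 1 x) = - integral {0..T} (\<lambda>x. U 2 x * V 0 x)" by simp
  have "integral {0..T} (\<lambda>x. U 4 x * V 0 x) = - integral {0..T} (\<lambda>x. U 3 x * V 1 x)"
    by (rule integral_by_parts_periodic) (use D C P assms(1) in auto)
  moreover have "integral {0..T} (\<lambda>x. U 3 x * V 1 x) = - integral {0..T} (\<lambda>x. U 2 x * V 2 x)"
    by (rule integral_by_parts_periodic) (use D C P assms(1) in auto)
  ultimately show "integral {0..T} (\<lambda>x. U 2 x * V 2 x) = integral {0..T} (\<lambda>x. U 4 x * V 0 x)" by simp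
qed

text \<open>The discriminant is negative, so the form is positive definite. With
  \<open>x = u\<close> and \<open>y = u''\<close>, where the mixed term integrates to
  \<open>- q\<close> times the integral of the square of \<open>u'\<close>, it bounds from below
  both the energy and the linear operator of the iteration.\<close>

lemma quadratic_form_coercive:
  fixes q a :: real
  assumes "q\<^sup>2 < 4 * a"
  obtains d where "d > 0" and "\<And>x y. d * (x\<^sup>2 + y\<^sup>2) \<le> y\<^sup>2 + q * (y * x) + a * x\<^sup>2"
proof -
  have a: "a > 0" using assms zero_le_power2[of q] by linarith
  \<comment> \<open>Determinant over trace of the matrix of the form, hence a positive number below
    its smaller eigenvalue.\<close>
  define d where "d = (4 * a - q\<^sup>2) / (4 * (1 + a))"
  have d: "d > 0" using assms a by (simp add: d_def)
  have deq: "4 * (1 + a) * d = 4 * a - q\<^sup>2" using a by (simp add: d_def)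
  have d1: "d < 1"
  proof -
    have "4 * a - q\<^sup>2 < 4 * (1 + a)" by (smt (verit) zero_le_power2)
    then show ?thesis using a by (simp add: d_def divide_less_eq)
  qed
  have "0 \<le> y\<^sup>2 + q * (y * x) + a * x\<^sup>2 - d * (x\<^sup>2 + y\<^sup>2)" for x y
  proof -
    \<comment> \<open>Completing the square in \<open>y\<close>.\<close>
    have "4 * (1 - d) * (y\<^sup>2 + q * (y * x) + a * x\<^sup>2 - d * (x\<^sup>2 + y\<^sup>2))
      = (2 * (1 - d) * y + q * x)\<^sup>2 + (4 * (1 - d) * (a - d) - q\<^sup>2) * x\<^sup>2"
      by algebra
    moreover have "4 * (1 - d) * (a - d) - q\<^sup>2 = 4 * d\<^sup>2" using deq by algebra
    ultimately have "0 \<le> (4 * (1 - d)) * (y\<^sup>2 + q * (y * x) + a * x\<^sup>2 - d * (x\<^sup>2 + y\<^sup>2))" by simp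
    then show ?thesis using d1 by (simp add: zero_le_mult_iff)
  qed
  then show ?thesis using that[of d] d by force
qed

text \<open>Between two points \<open>f^2\<close> changes by at most the integral of
  \<open>\<bar>2 f f'\<bar>\<close>, which is at most that of \<open>f^2 + f'^2\<close>. Averaging
  the resulting bound for \<open>(f x)^2\<close> over the second point gives the claim.\<close>

lemma periodic_sup_bound:
  fixes f f' :: "real \<Rightarrow> real"
  assumes T: "T > 0" and D: "\<And>x. (f has_real_derivative f' x) (at x)"
    and C: "continuous_on UNIV f'" and x: "x \<in> {0..T}"
  shows "(f x)\<^sup>2 \<le> (1 / T + 1) * integral {0..T} (\<lambda>x. (f x)\<^sup>2) + integral {0..T} (\<lambda>x. (f' x)\<^sup>2)"
proof -
  have cf: "continuous_on S f" for S using D by (rule has_real_derivative_imp_continuous_on)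
  have cf': "continuous_on S f'" for S using C continuous_on_subset by blast
  let ?I = "integral {0..T} (\<lambda>x. (f x)\<^sup>2)"
  let ?J = "integral {0..T} (\<lambda>x. (f' x)\<^sup>2)"
  have IJ: "integral {0..T} (\<lambda>x. (f x)\<^sup>2 + (f' x)\<^sup>2) = ?I + ?J"
    by (intro integral_add integrable_continuous_real continuous_intros cf cf')
  have key: "(f b)\<^sup>2 - (f a)\<^sup>2 \<le> ?I + ?J \<and> (f a)\<^sup>2 - (f b)\<^sup>2 \<le> ?I + ?J"
    if "0 \<le> a" "a \<le> b" "b \<le> T" for a b
  proof -
    have H: "((\<lambda>x. 2 * f x * f' x) has_integral ((f b)\<^sup>2 - (f a)\<^sup>2)) {a..b}"
    proof (rule fundamental_theorem_of_calculus)
      show "((\<lambda>x. (f x)\<^sup>2) has_vector_derivative 2 * f x * f' x) (at x within {a..b})" for x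
        unfolding has_real_derivative_iff_has_vector_derivative[symmetric]
        by (rule has_field_derivative_at_within) (auto intro!: derivative_eq_intros D)
    qed (use that in simp)
    have B: "integral {a..b} (\<lambda>x. (f x)\<^sup>2 + (f' x)\<^sup>2) \<le> ?I + ?J"
      unfolding IJ[symmetric]
      by (rule integral_subset_le)
        (use that in \<open>auto intro!: integrable_continuous_real continuous_intros cf cf'\<close>)
    have ab: "\<bar>2 * f x * f' x\<bar> \<le> (f x)\<^sup>2 + (f' x)\<^sup>2" for x
      using sum_squares_bound[of "f x" "f' x"] sum_squares_bound[of "- f x" "f' x"]
      by (simp add: abs_le_iff)
    have "(f b)\<^sup>2 - (f a)\<^sup>2 \<le> integral {a..b} (\<lambda>x. (f x)\<^sup>2 + (f' x)\<^sup>2)"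
      unfolding integral_unique[OF H, symmetric]
      by (rule integral_real_mono) (use ab in \<open>auto intro!: continuous_intros cf cf' simp: abs_le_iff\<close>)
    moreover have "- ((f b)\<^sup>2 - (f a)\<^sup>2) \<le> integral {a..b} (\<lambda>x. (f x)\<^sup>2 + (f' x)\<^sup>2)"
      unfolding integral_unique[OF has_integral_neg[OF H], symmetric]
      by (rule integral_real_mono) (use ab in \<open>auto intro!: continuous_intros cf cf' simp: abs_le_iff\<close>)
    ultimately show ?thesis using B by simp
  qed
  have "T * ((f x)\<^sup>2 - (?I + ?J)) = integral {0..T} (\<lambda>y. (f x)\<^sup>2 - (?I + ?J))"
    using T by simp
  also have "\<dots> \<le> ?I"
  proof (rule integral_real_mono)
    fix y assume y: "y \<in> {0..T}"
    show "(f x)\<^sup>2 - (?I + ?J) \<le> (f y)\<^sup>2"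
      using key[of x y] key[of y x] x y by (cases "x \<le> y") auto
  qed (auto intro!: continuous_intros cf)
  finally show ?thesis using T by (simp add: field_simps)
qed

text \<open>One and the same \<open>y\<close> serves all \<open>T\<close>-periodic functions, so
  several of them can be moved to the base period simultaneously.\<close>

lemma periodic_reduce:
  fixes x :: real
  assumes "T > 0"
  obtains y where "y \<in> {0..T}" and "\<And>f :: real \<Rightarrow> real. (\<And>x. f (x + T) = f x) \<Longrightarrow> f x = f y"
proof -
  define y where "y = x - of_int \<lfloor>x / T\<rfloor> * T"
  have "of_int \<lfloor>x / T\<rfloor> * T \<le> x" "x \<le> (of_int \<lfloor>x / T\<rfloor> + 1) * T"
    using assms by (simp_all add: pos_le_divide_eq[symmetric] pos_divide_le_eq[symmetric])
  then have "y \<in> {0..T}" by (simp add: y_def algebra_simps)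
  moreover have "f x = f y" if "\<And>x. f (x + T) = f x" for f :: "real \<Rightarrow> real"
  proof -
    interpret periodic_fun_simple f T by unfold_locales (rule that)
    show ?thesis using plus_of_int[of y "\<lfloor>x / T\<rfloor>"] by (simp add: y_def)
  qed
  ultimately show ?thesis using that by blast
qed

text \<open>The integral of \<open>u'^2\<close> is that of \<open>- u u''\<close>, so
  \<open>u\<close> and \<open>u''\<close> in the square norm control everything needed. The bound on
  \<open>U 1\<close> supplies equicontinuity later.\<close>

lemma periodic_chain_sup_bound:
  assumes T: "T > 0" and U: "periodic_chain T U"
  shows "(U 0 x)\<^sup>2 \<le> (1 / T + 2) * integral {0..T} (\<lambda>x. (U 0 x)\<^sup>2 + (U 2 x)\<^sup>2)"
    and "(U 1 x)\<^sup>2 \<le> (1 / T + 2) * integral {0..T} (\<lambda>x. (U 0 x)\<^sup>2 + (U 2 x)\<^sup>2)"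
proof -
  note C = periodic_chain_continuous[OF U]
  note D = periodic_chain_deriv[OF U]
  let ?I = "\<lambda>j. integral {0..T} (\<lambda>x. (U j x)\<^sup>2)"
  have I02: "integral {0..T} (\<lambda>x. (U 0 x)\<^sup>2 + (U 2 x)\<^sup>2) = ?I 0 + ?I 2"
    by (intro integral_add integrable_continuous_real continuous_intros C) auto
  have nn: "?I j \<ge> 0" if "j \<le> 4" for j
    by (intro integral_nonneg integrable_continuous_real continuous_intros C that) auto
  have "?I 1 = integral {0..T} (\<lambda>x. - (U 2 x * U 0 x))"
    using periodic_chain_by_parts(1)[OF T U U] by (simp add: power2_eq_square)
  also have "\<dots> \<le> integral {0..T} (\<lambda>x. ((U 0 x)\<^sup>2 + (U 2 x)\<^sup>2) / 2)"
  proof (rule integral_real_mono)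
    show "- (U 2 x * U 0 x) \<le> ((U 0 x)\<^sup>2 + (U 2 x)\<^sup>2) / 2" for x
      using sum_squares_bound[of "- U 0 x" "U 2 x"] by (simp add: algebra_simps)
  qed (intro continuous_intros C; simp)+
  finally have I1: "?I 1 \<le> (?I 0 + ?I 2) / 2" using I02 by simp
  obtain y where y: "y \<in> {0..T}" and yf: "\<And>f :: real \<Rightarrow> real. (\<And>x. f (x + T) = f x) \<Longrightarrow> f x = f y"
    using periodic_reduce[OF T] by blast
  have xy: "U 0 x = U 0 y" "U 1 x = U 1 y"
    using periodic_chain_periodic[OF U] by (auto intro!: yf)
  have T': "1 / T > 0" using T by simp
  have "(U 0 y)\<^sup>2 \<le> (1 / T + 1) * ?I 0 + ?I 1"
    by (rule periodic_sup_bound) (use T D C y in auto)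
  also have "\<dots> \<le> (1 / T + 1) * (?I 0 + ?I 2) + (?I 0 + ?I 2)"
    using T' I1 nn[of 0] nn[of 2] by (intro add_mono mult_left_mono) auto
  finally show "(U 0 x)\<^sup>2 \<le> (1 / T + 2) * integral {0..T} (\<lambda>x. (U 0 x)\<^sup>2 + (U 2 x)\<^sup>2)"
    unfolding I02 xy by (simp add: algebra_simps)
  have "(U 1 y)\<^sup>2 \<le> (1 / T + 1) * ?I 1 + ?I 2"
    by (rule periodic_sup_bound) (use T D C y in auto)
  also have "\<dots> \<le> (1 / T + 1) * (?I 0 + ?I 2) + (?I 0 + ?I 2)"
    using T' I1 nn[of 0] nn[of 2] by (intro add_mono mult_left_mono) auto
  finally show "(U 1 x)\<^sup>2 \<le> (1 / T + 2) * integral {0..T} (\<lambda>x. (U 0 x)\<^sup>2 + (U 2 x)\<^sup>2)"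
    unfolding I02 xy by (simp add: algebra_simps)
qed

section \<open>Periodic solutions of linear equations\<close>

text \<open>Variation of constants. As \<open>Re l\<close> is nonzero, the homogeneous equation has
  no nonzero \<open>T\<close>-periodic solution, and the free constant can be fitted to the
  period.\<close>

lemma periodic_first_order_solution:
  fixes l :: complex and f :: "real \<Rightarrow> real"
  assumes "T > 0" and "Re l \<noteq> 0" and f: "continuous_on UNIV f" and fT: "\<And>x. f (x + T) = f x"
  obtains z where "\<And>x. (z has_vector_derivative l * z x + of_real (f x)) (at x)"
    and "\<And>x. z (x + T) = z x"
proof -
  \<comment> \<open>With infinite endpoints the interval is the whole line, which yields a global
    antiderivative of the integrand.\<close>
  have "\<exists>H. \<forall>x::real. - \<infinity> < ereal x \<longrightarrow> ereal x < \<infinity> \<longrightarrow>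
      (H has_vector_derivative exp (- l * of_real x) * of_real (f x)) (at x)"
    by (rule einterval_antiderivative)
      (use f in \<open>auto intro!: continuous_intros simp: continuous_on_eq_continuous_at\<close>)
  then obtain H where H: "\<And>x::real. (H has_vector_derivative exp (- l * of_real x) * of_real (f x)) (at x)"
    by auto
  define E where "E = exp (l * of_real T)"
  have "norm E = exp (Re l * T)" by (simp add: E_def)
  then have "norm E \<noteq> 1" using assms(1,2) by simp
  then have E1: "E \<noteq> 1" by auto
  \<comment> \<open>The solution of \<open>z 0 = z T\<close> for the function \<open>z\<close>
    below.\<close>
  define c where "c = (E * H T - H 0) / (1 - E)"
  have c: "c + H 0 = E * (c + H T)" using E1 by (simp add: c_def field_simps)
  define z where "z = (\<lambda>x::real. exp (l * of_real x) * (c + H x))"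
  have ex: "((\<lambda>x::real. exp (l * of_real x)) has_vector_derivative l * exp (l * of_real x)) (at x)" for x
    by (rule has_vector_derivative_real_field) (auto intro!: derivative_eq_intros)
  have z: "(z has_vector_derivative l * z x + of_real (f x)) (at x)" for x
  proof -
    have "((\<lambda>x. c + H x) has_vector_derivative exp (- l * of_real x) * of_real (f x)) (at x)"
      using has_vector_derivative_add[OF has_vector_derivative_const H] by simp
    from has_vector_derivative_mult[OF ex this]
    show ?thesis
      by (simp add: z_def[symmetric] mult.assoc[symmetric] exp_minus) (simp add: z_def algebra_simps)
  qed
  \<comment> \<open>The derivative vanishes because \<open>f\<close> is periodic, and the value at 0
    vanishes by the choice of \<open>c\<close>.\<close>
  have "E * (c + H (x + T)) - (c + H x) = 0" for x
  proof -
    have "((\<lambda>x. E * (c + H (x + T)) - (c + H x)) has_vector_derivative 0) (at x)" for x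
    proof -
      have shift: "((\<lambda>x. x + T) has_vector_derivative 1) (at x)"
        unfolding has_real_derivative_iff_has_vector_derivative[symmetric]
        by (auto intro!: derivative_eq_intros)
      have "(H has_vector_derivative exp (- l * of_real (x + T)) * of_real (f (x + T))) (at (x + T))"
        by (rule H)
      then have "((\<lambda>x. H (x + T)) has_vector_derivative exp (- l * of_real (x + T)) * of_real (f (x + T))) (at x)"
        using vector_diff_chain_at[of "\<lambda>x. x + T" 1 x H] shift by (simp add: o_def)
      then have "((\<lambda>x. E * (c + H (x + T)) - (c + H x)) has_vector_derivative
          E * (0 + exp (- l * of_real (x + T)) * of_real (f (x + T))) - (0 + exp (- l * of_real x) * of_real (f x))) (at x)"
        using H by (intro has_vector_derivative_diff has_vector_derivative_add has_vector_derivative_const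
            has_vector_derivative_mult_right) auto
      moreover have "E * exp (- l * of_real (x + T)) = exp (- l * of_real x)"
        unfolding E_def exp_add[symmetric] by (simp add: algebra_simps)
      ultimately show ?thesis by (simp add: fT mult.assoc[symmetric])
    qed
    then obtain k where "\<And>x. E * (c + H (x + T)) - (c + H x) = k"
      using has_vector_derivative_zero_constant[of UNIV "\<lambda>x. E * (c + H (x + T)) - (c + H x)"] by auto
    from this[of x] this[of 0] show ?thesis using c by simp
  qed
  moreover have "exp (l * of_real (x + T)) = exp (l * of_real x) * E" for x
    by (simp add: E_def exp_add algebra_simps)
  ultimately have "z (x + T) = z x" for x by (simp add: z_def mult.assoc)
  with z that show ?thesis by blast
qed

text \<open>The characteristic roots are \<open>- p + i b\<close> and \<open>- p - i b\<close> with
  \<open>b^2 = s - p^2\<close>. If \<open>z\<close> solves the complex first-order equation for the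
  first root, then \<open>Im z / b\<close> is the required real solution.\<close>

lemma periodic_second_order_solution:
  fixes p s :: real
  assumes T: "T > 0" and p: "p \<noteq> 0" and s: "p\<^sup>2 < s"
    and f: "continuous_on UNIV f" and fT: "\<And>x. f (x + T) = f x"
  obtains v v' where "\<And>x. (v has_real_derivative v' x) (at x)"
    and "\<And>x. (v' has_real_derivative f x - 2 * p * v' x - s * v x) (at x)"
    and "\<And>x. v (x + T) = v x"
proof -
  define b where "b = sqrt (s - p\<^sup>2)"
  have b: "b > 0" and b2: "b * b = s - p\<^sup>2" using s by (simp_all add: b_def)
  obtain z where z: "\<And>x. (z has_vector_derivative Complex (- p) b * z x + of_real (f x)) (at x)"
    and zT: "\<And>x. z (x + T) = z x"
    using periodic_first_order_solution[of T "Complex (- p) b" f] T p f fT by auto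
  have re: "((\<lambda>x. Re (z x)) has_real_derivative - p * Re (z x) - b * Im (z x) + f x) (at x)" for x
    using bounded_linear.has_vector_derivative[OF bounded_linear_Re z[of x]]
    by (simp add: has_real_derivative_iff_has_vector_derivative)
  have im: "((\<lambda>x. Im (z x)) has_real_derivative b * Re (z x) - p * Im (z x)) (at x)" for x
    using bounded_linear.has_vector_derivative[OF bounded_linear_Im z[of x]]
    by (simp add: has_real_derivative_iff_has_vector_derivative algebra_simps)
  show ?thesis
  proof (rule that[of "\<lambda>x. Im (z x) / b" "\<lambda>x. Re (z x) - p * (Im (z x) / b)"])
    show "((\<lambda>x. Im (z x) / b) has_real_derivative Re (z x) - p * (Im (z x) / b)) (at x)" for x
      using DERIV_cdivide[OF im[of x], of b] b by (simp add: diff_divide_distrib)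
    show "((\<lambda>x. Re (z x) - p * (Im (z x) / b)) has_real_derivative
        f x - 2 * p * (Re (z x) - p * (Im (z x) / b)) - s * (Im (z x) / b)) (at x)" for x
    proof -
      have "s = b * b + p\<^sup>2" using b2 by simp
      then have eq: "- p * Re (z x) - b * Im (z x) + f x - p * ((b * Re (z x) - p * Im (z x)) / b) =
          f x - 2 * p * (Re (z x) - p * (Im (z x) / b)) - s * (Im (z x) / b)"
        using b by (simp add: field_simps power2_eq_square)
      show ?thesis
        by (rule DERIV_cong[OF DERIV_diff[OF re[of x] DERIV_cmult[OF DERIV_cdivide[OF im[of x], of b], of p]] eq])
    qed
  qed (simp add: zT)
qed

text \<open>The operator factors as \<open>(D\<^sup>2 + 2pD + s) (D\<^sup>2 - 2pD + s)\<close>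
  with \<open>s\<^sup>2 = a\<close> and \<open>4p\<^sup>2 = 2s - q\<close>.\<close>

lemma periodic_fourth_order_solution:
  fixes q a :: real
  assumes T: "T > 0" and q: "q > 0" and a: "q\<^sup>2 < 4 * a"
    and f: "continuous_on UNIV f" and fT: "\<And>x. f (x + T) = f x"
  obtains W where "periodic_chain T W" and "\<And>x. W 4 x + q * W 2 x + a * W 0 x = f x"
proof -
  define s where "s = sqrt a"
  have a0: "a > 0" using a zero_le_power2[of q] by linarith
  then have ss: "s * s = a" and s0: "s > 0" by (simp_all add: s_def)
  have "q\<^sup>2 < (2 * s)\<^sup>2" using a ss by (simp add: power2_eq_square)
  then have qs: "q < 2 * s" using power_less_imp_less_base[of q 2 "2 * s"] s0 by simp
  define p where "p = sqrt ((2 * s - q) / 4)"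
  have p0: "p > 0" and p2: "4 * p\<^sup>2 = 2 * s - q" using qs by (simp_all add: p_def)
  have ps: "p\<^sup>2 < s" using p2 q s0 by simp
  obtain v v' where v: "\<And>x. (v has_real_derivative v' x) (at x)"
    and v': "\<And>x. (v' has_real_derivative f x - 2 * p * v' x - s * v x) (at x)"
    and vT: "\<And>x. v (x + T) = v x"
    using periodic_second_order_solution[of T p s f] T p0 ps f fT by auto
  have vc: "continuous_on UNIV v" "continuous_on UNIV v'"
    by (rule has_real_derivative_imp_continuous_on, rule v v')+
  obtain w w' where w: "\<And>x. (w has_real_derivative w' x) (at x)"
    and w': "\<And>x. (w' has_real_derivative v x - 2 * (- p) * w' x - s * w x) (at x)"
    and wT: "\<And>x. w (x + T) = w x"
    using periodic_second_order_solution[of T "- p" s v] T p0 ps vc vT by auto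
  have wc: "continuous_on UNIV w" "continuous_on UNIV w'"
    by (rule has_real_derivative_imp_continuous_on, rule w w')+
  \<comment> \<open>The higher derivatives of \<open>w\<close> are read off by differentiating its
    equation, with the second derivative of \<open>v\<close> replaced by means of the equation for
    \<open>v\<close>.\<close>
  define w2 where "w2 = (\<lambda>x. v x + 2 * p * w' x - s * w x)"
  define w3 where "w3 = (\<lambda>x. v' x + 2 * p * w2 x - s * w' x)"
  define w4 where "w4 = (\<lambda>x. f x - 2 * p * v' x - s * v x + 2 * p * w3 x - s * w2 x)"
  define W where "W = (\<lambda>j::nat. if j = 0 then w else if j = 1 then w' else if j = 2 then w2
    else if j = 3 then w3 else w4)"
  have W: "W 0 = w" "W 1 = w'" "W 2 = w2" "W 3 = w3" "W 4 = w4" by (simp_all add: W_def)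
  have w'2: "(w' has_real_derivative w2 x) (at x)" for x using w'[of x] by (simp add: w2_def)
  have w23: "(w2 has_real_derivative w3 x) (at x)" for x
    unfolding w2_def[abs_def] w3_def by (auto intro!: derivative_eq_intros v w'2 w simp: w2_def)
  have w34: "(w3 has_real_derivative w4 x) (at x)" for x
    unfolding w3_def[abs_def] w4_def by (auto intro!: derivative_eq_intros v' w'2 w23 simp: w3_def)
  have "periodic_chain T W"
    by (rule periodic_chainI; unfold W)
      (use w w'2 w23 w34 wT f vc wc in
        \<open>auto intro!: continuous_intros simp: w4_def[abs_def] w3_def[abs_def] w2_def[abs_def]\<close>)
  moreover have "w4 x + q * w2 x + a * w x = f x" for x
    using p2 ss unfolding w4_def w3_def w2_def by algebra
  ultimately show ?thesis using that W by metis
qed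

section \<open>Energy estimates and the descent step\<close>

text \<open>The descent inequality of gradient methods. The mean value theorem gives it with
  \<open>L\<close> in place of the sharp constant \<open>L / 2\<close>.\<close>

lemma lipschitz_deriv_upper_bound:
  fixes G g :: "real \<Rightarrow> real"
  assumes G: "\<And>t. (G has_real_derivative g t) (at t)" and L: "\<And>s t. \<bar>g s - g t\<bar> \<le> L * \<bar>s - t\<bar>"
  shows "G b - G a \<le> g a * (b - a) + L * (b - a)\<^sup>2"
proof -
  have "\<exists>z. \<bar>z - a\<bar> \<le> \<bar>b - a\<bar> \<and> G b - G a = (b - a) * g z"
  proof (cases a b rule: linorder_cases)
    case less
    then obtain z where "a < z" "z < b" "G b - G a = (b - a) * g z"
      using MVT2[of a b G g] G by blast
    then show ?thesis by (intro exI[of _ z]) auto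
  next
    case greater
    then obtain z where "b < z" "z < a" "G a - G b = (a - b) * g z"
      using MVT2[of b a G g] G by blast
    then show ?thesis by (intro exI[of _ z]) (auto simp: algebra_simps)
  qed (auto intro: exI[of _ a])
  then obtain z where z: "\<bar>z - a\<bar> \<le> \<bar>b - a\<bar>" and eq: "G b - G a = (b - a) * g z" by blast
  have L0: "0 \<le> L" using L[of 0 1] by simp
  have "G b - G a - g a * (b - a) = (b - a) * (g z - g a)" using eq by (simp add: algebra_simps)
  also have "\<dots> \<le> \<bar>b - a\<bar> * \<bar>g z - g a\<bar>" using abs_ge_self[of "(b - a) * (g z - g a)"] by (simp add: abs_mult)
  also have "\<dots> \<le> \<bar>b - a\<bar> * (L * \<bar>b - a\<bar>)"
    using L[of z a] z L0 by (intro mult_left_mono) (auto intro: order_trans mult_left_mono)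
  finally show ?thesis by (simp add: power2_eq_square algebra_simps abs_mult_self_eq)
qed

lemma lipschitz_imp_continuous:
  fixes g :: "real \<Rightarrow> real"
  assumes "\<And>s t. \<bar>g s - g t\<bar> \<le> L * \<bar>s - t\<bar>"
  shows "continuous_on UNIV g"
proof -
  have "0 \<le> L" using assms[of 0 1] by simp
  then have "L-lipschitz_on UNIV g"
    using assms by (auto intro!: lipschitz_onI simp: dist_real_def)
  then show ?thesis by (rule lipschitz_on_continuous_on)
qed

text \<open>The quadratic part is expanded at the new point \<open>W\<close> and \<open>G\<close> at
  the old point \<open>U\<close>, which matches the semi-implicit scheme. Expansion at
  \<open>W\<close> leaves minus half the square of \<open>D 2\<close>, and this absorbs the bad term
  \<open>q / 2 * (D 1)^2\<close> after integration by parts.\<close>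

lemma energy_diff_le:
  assumes T: "T > 0" and U: "periodic_chain T U" and W: "periodic_chain T W"
    and G: "\<And>t. (G has_real_derivative g t) (at t)" and L: "\<And>s t. \<bar>g s - g t\<bar> \<le> L * \<bar>s - t\<bar>"
  shows "energy T q G W - energy T q G U \<le>
    integral {0..T} (\<lambda>x. (W 4 x + q * W 2 x + g (U 0 x)) * (W 0 x - U 0 x)
      + (L + q\<^sup>2 / 8) * (W 0 x - U 0 x)\<^sup>2)"
proof -
  let ?I = "integral {0..T}"
  define D where "D = (\<lambda>j x. W j x - U j x)"
  have D: "periodic_chain T D" unfolding D_def by (rule periodic_chain_diff[OF W U])
  note C = periodic_chain_continuous[OF U] periodic_chain_continuous[OF W] periodic_chain_continuous[OF D]
  have Gc: "continuous_on UNIV G" using G by (rule has_real_derivative_imp_continuous_on)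
  have gc: "continuous_on UNIV g" using L by (rule lipschitz_imp_continuous)
  have GC: "continuous_on {0..T} (\<lambda>x. G (U 0 x))" "continuous_on {0..T} (\<lambda>x. G (W 0 x))"
      "continuous_on {0..T} (\<lambda>x. g (U 0 x))"
    by (rule continuous_on_compose2[OF Gc] continuous_on_compose2[OF gc]; use C in simp)+
  note int = integrable_continuous_real continuous_intros C GC
  \<comment> \<open>The terms that take no part in the integration by parts.\<close>
  define R where "R = (\<lambda>x. - (D 2 x)\<^sup>2 / 2 + G (W 0 x) - G (U 0 x))"
  have Rc: "continuous_on {0..T} R" unfolding R_def by (intro int) auto
  have "energy T q G W - energy T q G U =
    ?I (\<lambda>x. ((W 2 x)\<^sup>2 / 2 - q / 2 * (W 1 x)\<^sup>2 + G (W 0 x)) - ((U 2 x)\<^sup>2 / 2 - q / 2 * (U 1 x)\<^sup>2 + G (U 0 x)))"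
    unfolding energy_def by (rule integral_diff[symmetric]; intro int; simp)
  also have "\<dots> = ?I (\<lambda>x. W 2 x * D 2 x + (- q) * (W 1 x * D 1 x) + q / 2 * (D 1 x * D 1 x) + R x)"
    by (rule integral_cong) (simp add: D_def R_def power2_eq_square field_simps)
  also have "\<dots> = ?I (\<lambda>x. W 2 x * D 2 x) + (- q) * ?I (\<lambda>x. W 1 x * D 1 x) + q / 2 * ?I (\<lambda>x. D 1 x * D 1 x) + ?I R"
    by (subst integral_add, (intro int Rc; simp), (intro int Rc; simp))+ simp
  also have "\<dots> = ?I (\<lambda>x. W 4 x * D 0 x) + q * ?I (\<lambda>x. W 2 x * D 0 x) + (- q / 2) * ?I (\<lambda>x. D 2 x * D 0 x) + ?I R"
    unfolding periodic_chain_by_parts[OF T W D] periodic_chain_by_parts[OF T D D] by simp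
  also have "\<dots> = ?I (\<lambda>x. W 4 x * D 0 x + q * (W 2 x * D 0 x) + (- q / 2) * (D 2 x * D 0 x) + R x)"
    by (subst integral_add, (intro int Rc; simp), (intro int Rc; simp))+ simp
  also have "\<dots> \<le> ?I (\<lambda>x. (W 4 x + q * W 2 x + g (U 0 x)) * (W 0 x - U 0 x)
      + (L + q\<^sup>2 / 8) * (W 0 x - U 0 x)\<^sup>2)"
  proof (rule integral_real_mono)
    fix x
    \<comment> \<open>This square is the source of the constant
      \<open>q\<^sup>2 / 8\<close>.\<close>
    have "0 \<le> (D 2 x + q / 2 * D 0 x)\<^sup>2 / 2" by simp
    then have "- (D 2 x)\<^sup>2 / 2 + (- q / 2) * (D 2 x * D 0 x) \<le> q\<^sup>2 / 8 * (D 0 x)\<^sup>2"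
      by (simp add: power2_eq_square field_simps)
    moreover have "G (W 0 x) - G (U 0 x) \<le> g (U 0 x) * D 0 x + L * (D 0 x)\<^sup>2"
      unfolding D_def by (rule lipschitz_deriv_upper_bound[OF G L])
    ultimately show "W 4 x * D 0 x + q * (W 2 x * D 0 x) + (- q / 2) * (D 2 x * D 0 x) + R x \<le>
       (W 4 x + q * W 2 x + g (U 0 x)) * (W 0 x - U 0 x) + (L + q\<^sup>2 / 8) * (W 0 x - U 0 x)\<^sup>2"
      unfolding R_def D_def[symmetric] by (simp add: algebra_simps D_def)
  qed (intro int Rc; simp)+
  finally show ?thesis .
qed

lemma le_zero_if_le_small_multiples:
  fixes x C :: real
  assumes "\<And>e. 0 < e \<Longrightarrow> e < 1 \<Longrightarrow> x \<le> C * e"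
  shows "x \<le> 0"
proof (rule tendsto_lowerbound)
  show "((\<lambda>e. C * e) \<longlongrightarrow> 0) (at_right 0)"
    by (auto intro!: tendsto_eq_intros)
  show "\<forall>\<^sub>F e in at_right 0. x \<le> C * e"
    using assms by (auto simp: eventually_at_right_field intro!: exI[of _ 1])
qed simp

text \<open>After the \<open>u'\<close> term is rewritten by parts, the integrand dominates half the
  quadratic form with coefficient \<open>2 * c\<close>. The order of quantifiers matters:
  \<open>K\<close> is fixed before \<open>G\<close> and \<open>b\<close>, so it can be used to
  decide where \<open>F\<close> is modified.\<close>

lemma energy_coercive:
  assumes T: "T > 0" and c: "q\<^sup>2 < 8 * c"
  shows "\<exists>K>0. \<forall>U G b. periodic_chain T U \<longrightarrow> continuous_on UNIV G \<longrightarrow> (\<forall>t. c * t\<^sup>2 - b \<le> G t)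
      \<longrightarrow> integral {0..T} (\<lambda>x. (U 0 x)\<^sup>2 + (U 2 x)\<^sup>2) \<le> K * (energy T q G U + b * T)"
proof -
  obtain d where d: "d > 0" and dq: "\<And>x y. d * (x\<^sup>2 + y\<^sup>2) \<le> y\<^sup>2 + q * (y * x) + (2 * c) * x\<^sup>2"
    using quadratic_form_coercive[of q "2 * c"] c by auto
  have "integral {0..T} (\<lambda>x. (U 0 x)\<^sup>2 + (U 2 x)\<^sup>2) \<le> (2 / d) * (energy T q G U + b * T)"
    if U: "periodic_chain T U" and G: "continuous_on UNIV G" and Gb: "\<And>t. c * t\<^sup>2 - b \<le> G t" for U G b
  proof -
    let ?I = "integral {0..T}"
    note C = periodic_chain_continuous[OF U]
    have GC: "continuous_on {0..T} (\<lambda>x. G (U 0 x))"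
      by (rule continuous_on_compose2[OF G]; use C in simp)
    note int = integrable_continuous_real continuous_intros C GC
    have "d / 2 * ?I (\<lambda>x. (U 0 x)\<^sup>2 + (U 2 x)\<^sup>2) = ?I (\<lambda>x. d / 2 * ((U 0 x)\<^sup>2 + (U 2 x)\<^sup>2))"
      by simp
    also have "\<dots> \<le> ?I (\<lambda>x. ((U 2 x)\<^sup>2 / 2 + G (U 0 x) + b) + q / 2 * (U 2 x * U 0 x))"
    proof (rule integral_real_mono)
      show "d / 2 * ((U 0 x)\<^sup>2 + (U 2 x)\<^sup>2) \<le> ((U 2 x)\<^sup>2 / 2 + G (U 0 x) + b) + q / 2 * (U 2 x * U 0 x)" for x
        using dq[of "U 0 x" "U 2 x"] Gb[of "U 0 x"] by (simp add: field_simps)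
    qed (intro int; simp)+
    also have "\<dots> = ?I (\<lambda>x. (U 2 x)\<^sup>2 / 2 + G (U 0 x) + b) + q / 2 * ?I (\<lambda>x. U 2 x * U 0 x)"
      by (subst integral_add, (intro int; simp), (intro int; simp)) simp
    also have "\<dots> = ?I (\<lambda>x. (U 2 x)\<^sup>2 / 2 + G (U 0 x) + b) + (- q / 2) * ?I (\<lambda>x. U 1 x * U 1 x)"
      unfolding periodic_chain_by_parts[OF T U U] by simp
    also have "\<dots> = ?I (\<lambda>x. (U 2 x)\<^sup>2 / 2 + G (U 0 x) + b + (- q / 2) * (U 1 x * U 1 x))"
      by (subst integral_add, (intro int; simp), (intro int; simp)) simp
    also have "\<dots> = ?I (\<lambda>x. ((U 2 x)\<^sup>2 / 2 - q / 2 * (U 1 x)\<^sup>2 + G (U 0 x)) + b)"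
      by (rule integral_cong) (simp add: power2_eq_square)
    also have "\<dots> = energy T q G U + ?I (\<lambda>x. b)"
      unfolding energy_def by (rule integral_add; intro int; simp)
    also have "?I (\<lambda>x. b) = b * T" using T by simp
    finally show ?thesis using d by (simp add: field_simps)
  qed
  then show ?thesis using d by (intro exI[of _ "2 / d"]) auto
qed

text \<open>Testing the equation with \<open>Y\<close> itself and using coercivity. Applied to
  differences, it shows that solutions depend continuously on the right-hand side in the sup
  norm.\<close>

lemma linear_equation_sup_bound:
  assumes T: "T > 0" and a: "q\<^sup>2 < 4 * a"
  shows "\<exists>K>0. \<forall>Y e. periodic_chain T Y \<longrightarrow> (\<forall>x. \<bar>Y 4 x + q * Y 2 x + a * Y 0 x\<bar> \<le> e)
    \<longrightarrow> (\<forall>x. \<bar>Y 0 x\<bar> \<le> K * e)"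
proof -
  obtain d where d: "d > 0" and dq: "\<And>x y. d * (x\<^sup>2 + y\<^sup>2) \<le> y\<^sup>2 + q * (y * x) + a * x\<^sup>2"
    using quadratic_form_coercive[OF a] by blast
  define K where "K = sqrt (1 + 2 * T) / d"
  have K: "K > 0" using T d by (simp add: K_def)
  have "\<bar>Y 0 x\<bar> \<le> K * e"
    if Y: "periodic_chain T Y" and e: "\<And>x. \<bar>Y 4 x + q * Y 2 x + a * Y 0 x\<bar> \<le> e" for Y e x
  proof -
    let ?I = "integral {0..T}"
    let ?N = "?I (\<lambda>x. (Y 0 x)\<^sup>2 + (Y 2 x)\<^sup>2)"
    note C = periodic_chain_continuous[OF Y]
    note int = integrable_continuous_real continuous_intros C
    have e0: "e \<ge> 0" using e[of 0] by linarith
    have "d * ?N = ?I (\<lambda>x. d * ((Y 0 x)\<^sup>2 + (Y 2 x)\<^sup>2))" by simp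
    also have "\<dots> \<le> ?I (\<lambda>x. Y 2 x * Y 2 x + (q * (Y 2 x * Y 0 x) + a * (Y 0 x)\<^sup>2))"
    proof (rule integral_real_mono)
      show "d * ((Y 0 x)\<^sup>2 + (Y 2 x)\<^sup>2) \<le> Y 2 x * Y 2 x + (q * (Y 2 x * Y 0 x) + a * (Y 0 x)\<^sup>2)" for x
        using dq[of "Y 0 x" "Y 2 x"] by (simp add: power2_eq_square)
    qed (intro int; simp)+
    also have "\<dots> = ?I (\<lambda>x. Y 2 x * Y 2 x) + ?I (\<lambda>x. q * (Y 2 x * Y 0 x) + a * (Y 0 x)\<^sup>2)"
      by (rule integral_add; intro int; simp)
    also have "\<dots> = ?I (\<lambda>x. Y 4 x * Y 0 x) + ?I (\<lambda>x. q * (Y 2 x * Y 0 x) + a * (Y 0 x)\<^sup>2)"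
      unfolding periodic_chain_by_parts(2)[OF T Y Y] ..
    also have "\<dots> = ?I (\<lambda>x. Y 4 x * Y 0 x + (q * (Y 2 x * Y 0 x) + a * (Y 0 x)\<^sup>2))"
      by (rule integral_add[symmetric]; intro int; simp)
    also have "\<dots> \<le> ?I (\<lambda>x. e\<^sup>2 / (2 * d) + d / 2 * ((Y 0 x)\<^sup>2 + (Y 2 x)\<^sup>2))"
    proof (rule integral_real_mono)
      fix x
      have "Y 4 x * Y 0 x + (q * (Y 2 x * Y 0 x) + a * (Y 0 x)\<^sup>2) = (Y 4 x + q * Y 2 x + a * Y 0 x) * Y 0 x"
        by (simp add: algebra_simps power2_eq_square)
      also have "\<dots> \<le> e * \<bar>Y 0 x\<bar>"
        using mult_right_mono[OF e[of x], of "\<bar>Y 0 x\<bar>"] by (simp add: abs_mult[symmetric])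
      also have "\<dots> \<le> e\<^sup>2 / (2 * d) + d / 2 * (Y 0 x)\<^sup>2"
      proof -
        \<comment> \<open>Young's inequality, weighted so that half of the coercive term absorbs the
          product.\<close>
        have "0 \<le> (e - d * \<bar>Y 0 x\<bar>)\<^sup>2" by simp
        then have "2 * d * (e * \<bar>Y 0 x\<bar>) \<le> e\<^sup>2 + d\<^sup>2 * (Y 0 x)\<^sup>2"
          by (simp add: power2_diff power_mult_distrib algebra_simps)
        then show ?thesis using d by (simp add: field_simps power2_eq_square)
      qed
      also have "\<dots> \<le> e\<^sup>2 / (2 * d) + d / 2 * ((Y 0 x)\<^sup>2 + (Y 2 x)\<^sup>2)" using d by simp
      finally show "Y 4 x * Y 0 x + (q * (Y 2 x * Y 0 x) + a * (Y 0 x)\<^sup>2) \<le>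
        e\<^sup>2 / (2 * d) + d / 2 * ((Y 0 x)\<^sup>2 + (Y 2 x)\<^sup>2)" .
    qed (intro int; use d in simp)+
    also have "\<dots> = T * (e\<^sup>2 / (2 * d)) + d / 2 * ?N"
      by (subst integral_add, (intro int; simp), (intro int; simp)) (use T in simp)
    finally have N: "?N \<le> T * e\<^sup>2 / d\<^sup>2" using d by (simp add: field_simps power2_eq_square)
    have "(Y 0 x)\<^sup>2 \<le> (1 / T + 2) * ?N" by (rule periodic_chain_sup_bound(1)[OF T Y])
    also have "\<dots> \<le> (1 / T + 2) * (T * e\<^sup>2 / d\<^sup>2)" using N T by (intro mult_left_mono) auto
    also have "\<dots> = (K * e)\<^sup>2"
      using T d by (simp add: K_def power_mult_distrib power_divide field_simps)
    finally show ?thesis using K e0 by (metis abs_le_square_iff abs_of_nonneg mult_nonneg_nonneg less_imp_le)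
  qed
  then show ?thesis using K by blast
qed

text \<open>The choice of \<open>a\<close> absorbs both the Lipschitz constant of \<open>g\<close> and the indefinite term
  of the energy.\<close>

lemma descent_step:
  assumes T: "T > 0" and q: "q > 0" and U: "periodic_chain T U"
    and G: "\<And>t. (G has_real_derivative g t) (at t)" and L: "\<And>s t. \<bar>g s - g t\<bar> \<le> L * \<bar>s - t\<bar>"
    and a: "a = L + q\<^sup>2 / 4 + 1"
  obtains W where "periodic_chain T W"
    and "\<And>x. W 4 x + q * W 2 x + a * W 0 x = a * U 0 x - g (U 0 x)"
    and "energy T q G W + integral {0..T} (\<lambda>x. (W 0 x - U 0 x)\<^sup>2) \<le> energy T q G U"
proof -
  have L0: "0 \<le> L" using L[of 0 1] by simp
  have qa: "q\<^sup>2 < 4 * a" using L0 by (simp add: a)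
  have gc: "continuous_on UNIV g" using L by (rule lipschitz_imp_continuous)
  have fc: "continuous_on UNIV (\<lambda>x. a * U 0 x - g (U 0 x))"
    by (intro continuous_intros continuous_on_compose2[OF gc] periodic_chain_continuous[OF U]) auto
  have fT: "a * U 0 (x + T) - g (U 0 (x + T)) = a * U 0 x - g (U 0 x)" for x
    using periodic_chain_periodic[OF U, of 0] by simp
  obtain W where W: "periodic_chain T W"
    and eq: "\<And>x. W 4 x + q * W 2 x + a * W 0 x = a * U 0 x - g (U 0 x)"
    using periodic_fourth_order_solution[OF T q qa fc fT] by blast
  note C = periodic_chain_continuous[OF U] periodic_chain_continuous[OF W]
  have gC: "continuous_on {0..T} (\<lambda>x. g (U 0 x))"
    by (rule continuous_on_compose2[OF gc]; use C in simp)
  have "energy T q G W - energy T q G U \<le>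
    integral {0..T} (\<lambda>x. (W 4 x + q * W 2 x + g (U 0 x)) * (W 0 x - U 0 x)
      + (L + q\<^sup>2 / 8) * (W 0 x - U 0 x)\<^sup>2)"
    by (rule energy_diff_le[OF T U W G L])
  also have "\<dots> \<le> integral {0..T} (\<lambda>x. - (W 0 x - U 0 x)\<^sup>2)"
  proof (rule integral_real_mono)
    fix x
    have "W 4 x + q * W 2 x + g (U 0 x) = - a * (W 0 x - U 0 x)"
      using eq[of x] by (simp add: algebra_simps)
    then have "(W 4 x + q * W 2 x + g (U 0 x)) * (W 0 x - U 0 x) + (L + q\<^sup>2 / 8) * (W 0 x - U 0 x)\<^sup>2
      = - ((q\<^sup>2 / 8 + 1) * (W 0 x - U 0 x)\<^sup>2)"
      unfolding a by (simp only:) (simp add: field_simps power2_eq_square)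
    also have "\<dots> \<le> - (W 0 x - U 0 x)\<^sup>2"
      by (simp add: algebra_simps)
    finally show "(W 4 x + q * W 2 x + g (U 0 x)) * (W 0 x - U 0 x) + (L + q\<^sup>2 / 8) * (W 0 x - U 0 x)\<^sup>2
      \<le> - (W 0 x - U 0 x)\<^sup>2" .
  qed (intro continuous_intros C gC; simp)+
  finally show ?thesis using that[OF W eq] by simp
qed

section \<open>Compactness and the limit of the descent\<close>

text \<open>The sup bounds on \<open>V n 0\<close> and \<open>V n 1\<close> allow Arzela-Ascoli on
  one period; periodicity carries the convergence to the whole line.\<close>

lemma uniform_limit_of_bounded_periodic_chains:
  assumes T: "T > 0" and V: "\<And>n. periodic_chain T (V n)"
    and B: "\<And>n. integral {0..T} (\<lambda>x. (V n 0 x)\<^sup>2 + (V n 2 x)\<^sup>2) \<le> B"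
  shows "\<exists>v k. continuous_on UNIV v \<and> (\<forall>x. v (x + T) = v x) \<and> strict_mono (k :: nat \<Rightarrow> nat) \<and>
    (\<forall>e>0. \<exists>N. \<forall>n\<ge>N. \<forall>x. \<bar>V (k n) 0 x - v x\<bar> < e)"
proof -
  define M where "M = sqrt ((1 / T + 2) * B)"
  have sq: "\<bar>y\<bar> \<le> M" if "y\<^sup>2 \<le> (1 / T + 2) * integral {0..T} (\<lambda>x. (V n 0 x)\<^sup>2 + (V n 2 x)\<^sup>2)" for y n
  proof -
    have "y\<^sup>2 \<le> (1 / T + 2) * B"
      using that mult_left_mono[OF B[of n], of "1 / T + 2"] T by simp
    then show ?thesis unfolding M_def by (metis real_sqrt_abs real_sqrt_le_iff)
  qed
  have b0: "\<bar>V n 0 x\<bar> \<le> M" and b1: "\<bar>V n 1 x\<bar> \<le> M" for n x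
    by (rule sq[OF periodic_chain_sup_bound(1)[OF T V]] sq[OF periodic_chain_sup_bound(2)[OF T V]])+
  have M0: "M \<ge> 0" using b0[of 0 0] by linarith
  have lip: "\<bar>V n 0 x - V n 0 y\<bar> \<le> M * \<bar>x - y\<bar>" for n x y
    using field_differentiable_bound[of UNIV "V n 0" "V n 1" M x y] periodic_chain_deriv(1)[OF V] b1
    by simp
  obtain v0 and k :: "nat \<Rightarrow> nat" where k: "strict_mono k"
    and v0: "\<And>e. 0 < e \<Longrightarrow> \<exists>N. \<forall>n x. n \<ge> N \<and> x \<in> {0..T} \<longrightarrow> norm (V (k n) 0 x - v0 x) < e"
  proof (rule Arzela_Ascoli[of "{0..T}" "\<lambda>n. V n 0" M])
    show "norm (V n 0 x) \<le> M" for n x using b0 by simp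
    show "\<exists>d>0. \<forall>n y. y \<in> {0..T} \<and> norm (x - y) < d \<longrightarrow> norm (V n 0 x - V n 0 y) < e"
      if "0 < e" for x e
    proof (intro exI[of _ "e / (M + 1)"] conjI allI impI)
      show "e / (M + 1) > 0" using that M0 by simp
      fix n y assume "y \<in> {0..T} \<and> norm (x - y) < e / (M + 1)"
      then have "\<bar>x - y\<bar> * (M + 1) < e" using M0 by (simp add: field_simps)
      moreover have "M * \<bar>x - y\<bar> \<le> \<bar>x - y\<bar> * (M + 1)" by (simp add: algebra_simps)
      ultimately show "norm (V n 0 x - V n 0 y) < e" using lip[of n x y] by simp
    qed
  qed auto
  \<comment> \<open>The limit \<open>v0\<close> is controlled only on \<open>{0..T}\<close>;
    composing it with the reduction \<open>r\<close> gives the periodic limit.\<close>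
  have "\<exists>y. y \<in> {0..T} \<and> (\<forall>f :: real \<Rightarrow> real. (\<forall>x. f (x + T) = f x) \<longrightarrow> f x = f y)" for x
    using periodic_reduce[OF T, of x] by metis
  then obtain r where r: "\<And>x. r x \<in> {0..T}"
    and rf: "\<And>x f. (\<And>x. f (x + T) = f x) \<Longrightarrow> (f :: real \<Rightarrow> real) x = f (r x)"
    by metis
  define v where "v x = v0 (r x)" for x
  have conv: "\<exists>N. \<forall>n\<ge>N. \<forall>x. \<bar>V (k n) 0 x - v x\<bar> < e" if e: "e > 0" for e
  proof -
    obtain N where N: "\<And>n x. n \<ge> N \<Longrightarrow> x \<in> {0..T} \<Longrightarrow> \<bar>V (k n) 0 x - v0 x\<bar> < e"
      using v0[OF e] by auto
    have "V (k n) 0 x = V (k n) 0 (r x)" for n x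
      by (rule rf) (rule periodic_chain_periodic[OF V], simp)
    then show ?thesis using N r unfolding v_def by metis
  qed
  have ul: "uniform_limit UNIV (\<lambda>n. V (k n) 0) v sequentially"
    using conv by (auto simp: uniform_limit_sequentially_iff dist_real_def)
  have "continuous_on UNIV v"
    by (rule uniform_limit_theorem[OF _ ul]) (auto intro!: always_eventually periodic_chain_continuous[OF V])
  moreover have "v (x + T) = v x" for x
  proof -
    have "(\<lambda>n. V (k n) 0 y) \<longlonglongrightarrow> v y" for y
      using ul by (rule tendsto_uniform_limitI) simp
    from this[of x] this[of "x + T"] show ?thesis
      using periodic_chain_periodic[OF V, of 0] by (auto intro: LIMSEQ_unique)
  qed
  ultimately show ?thesis using k conv by (intro exI[of _ v] exI[of _ k]) simp
qed

text \<open>The limit \<open>v\<close> of the iterates is a priori only continuous. One step of the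
  iteration applied to \<open>v\<close> produces a chain \<open>W\<close>, and the identity
  \<open>W 0 = v\<close> gives both regularity and the equation.\<close>

lemma periodic_solution_below_energy:
  assumes T: "T > 0" and q: "q > 0" and c: "q\<^sup>2 < 8 * c" and U: "periodic_chain T U"
    and G: "\<And>t. (G has_real_derivative g t) (at t)" and L: "\<And>s t. \<bar>g s - g t\<bar> \<le> L * \<bar>s - t\<bar>"
    and Gb: "\<And>t. c * t\<^sup>2 - b \<le> G t"
  obtains W where "periodic_chain T W" and "\<And>x. W 4 x + q * W 2 x + g (W 0 x) = 0"
    and "energy T q G W \<le> energy T q G U"
proof -
  let ?E = "energy T q G"
  let ?I = "integral {0..T}"
  have L0: "0 \<le> L" using L[of 0 1] by simp
  have gc: "continuous_on UNIV g" using L by (rule lipschitz_imp_continuous)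
  have Gc: "continuous_on UNIV G" using G by (rule has_real_derivative_imp_continuous_on)
  define a where "a = L + q\<^sup>2 / 4 + 1"
  have qa: "q\<^sup>2 < 4 * a" and a0: "a > 0" using L0 by (simp_all add: a_def add_nonneg_pos)
  define step where "step V W \<longleftrightarrow> (\<forall>x. W 4 x + q * W 2 x + a * W 0 x = a * V 0 x - g (V 0 x))
      \<and> ?E W + ?I (\<lambda>x. (W 0 x - V 0 x)\<^sup>2) \<le> ?E V" for V W :: "nat \<Rightarrow> real \<Rightarrow> real"
  \<comment> \<open>The clause for \<open>n = 0\<close> pins the start of the chosen sequence to
    \<open>U\<close>.\<close>
  have "\<exists>V. \<forall>n. (periodic_chain T (V n) \<and> (n = 0 \<longrightarrow> V n = U)) \<and> step (V n) (V (Suc n))"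
  proof (rule dependent_nat_choice)
    show "\<exists>V. periodic_chain T V \<and> ((0::nat) = 0 \<longrightarrow> V = U)" using U by blast
    show "\<exists>W. (periodic_chain T W \<and> (Suc n = 0 \<longrightarrow> W = U)) \<and> step V W"
      if "periodic_chain T V \<and> (n = 0 \<longrightarrow> V = U)" for V n
    proof -
      from that have "periodic_chain T V" ..
      from descent_step[OF T q this G L a_def] obtain W where "periodic_chain T W" "step V W"
        unfolding step_def by blast
      then show ?thesis by auto
    qed
  qed
  then obtain V where V: "\<And>n. periodic_chain T (V n)" and V0: "V 0 = U" and st: "\<And>n. step (V n) (V (Suc n))"
    by blast
  have eq: "V (Suc n) 4 x + q * V (Suc n) 2 x + a * V (Suc n) 0 x = a * V n 0 x - g (V n 0 x)" for n x
    using st by (simp add: step_def)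
  define \<delta> where "\<delta> n = ?I (\<lambda>x. (V (Suc n) 0 x - V n 0 x)\<^sup>2)" for n
  have dec: "?E (V (Suc n)) + \<delta> n \<le> ?E (V n)" for n using st by (simp add: step_def \<delta>_def)
  have \<delta>0: "\<delta> n \<ge> 0" for n unfolding \<delta>_def
    by (intro integral_nonneg integrable_continuous_real continuous_intros periodic_chain_continuous[OF V]) auto
  have decE: "decseq (\<lambda>n. ?E (V n))"
    by (rule decseq_SucI) (use dec \<delta>0 in \<open>smt (verit)\<close>)
  have EU: "?E (V n) \<le> ?E U" for n using decseqD[OF decE, of 0 n] V0 by simp
  obtain K where K: "K > 0" and coer': "\<forall>U G b. periodic_chain T U \<longrightarrow> continuous_on UNIV G \<longrightarrow> (\<forall>t. c * t\<^sup>2 - b \<le> G t)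
      \<longrightarrow> ?I (\<lambda>x. (U 0 x)\<^sup>2 + (U 2 x)\<^sup>2) \<le> K * (energy T q G U + b * T)"
    using energy_coercive[OF T c] by blast
  have coer: "?I (\<lambda>x. (V n 0 x)\<^sup>2 + (V n 2 x)\<^sup>2) \<le> K * (?E (V n) + b * T)" for n
    using coer' V Gc Gb by blast
  have "0 \<le> ?E (V n) + b * T" for n
  proof -
    have "0 \<le> ?I (\<lambda>x. (V n 0 x)\<^sup>2 + (V n 2 x)\<^sup>2)"
      by (intro integral_nonneg integrable_continuous_real continuous_intros periodic_chain_continuous[OF V]) auto
    then show ?thesis using coer[of n] K by (smt (verit) mult_pos_neg)
  qed
  then have "- b * T \<le> ?E (V n)" for n by (smt (verit) mult_minus_left)
  then obtain E0 where E0: "(\<lambda>n. ?E (V n)) \<longlonglongrightarrow> E0"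
    using decseq_convergent[OF decE] by blast
  have "(\<lambda>n. ?E (V n) - ?E (V (Suc n))) \<longlonglongrightarrow> E0 - E0"
    by (intro tendsto_diff E0 LIMSEQ_Suc)
  \<comment> \<open>The energies converge, being decreasing and bounded below, so their successive
    differences, which dominate \<delta>, tend to 0.\<close>
  then have \<delta>lim: "\<delta> \<longlonglongrightarrow> 0"
    using dec \<delta>0 by (intro tendsto_sandwich[of "\<lambda>n. 0" \<delta> sequentially "\<lambda>n. ?E (V n) - ?E (V (Suc n))"])
      (auto intro!: always_eventually simp: algebra_simps)
  have bound: "?I (\<lambda>x. (V n 0 x)\<^sup>2 + (V n 2 x)\<^sup>2) \<le> K * (?E U + b * T)" for n
    by (rule order_trans[OF coer[of n] mult_left_mono]) (use EU[of n] K in auto)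
  obtain v and k :: "nat \<Rightarrow> nat" where vc: "continuous_on UNIV v" and vT: "\<forall>x. v (x + T) = v x"
    and k: "strict_mono k" and conv: "\<forall>e>0. \<exists>N. \<forall>n\<ge>N. \<forall>x. \<bar>V (k n) 0 x - v x\<bar> < e"
    using uniform_limit_of_bounded_periodic_chains[of T V, OF T V bound] by (elim exE conjE) (rule that)
  have fc: "continuous_on UNIV (\<lambda>x. a * v x - g (v x))"
    by (intro continuous_intros continuous_on_compose2[OF gc] vc) auto
  have fT: "a * v (x + T) - g (v (x + T)) = a * v x - g (v x)" for x by (simp add: vT)
  obtain W where W: "periodic_chain T W"
    and Weq: "\<And>x. W 4 x + q * W 2 x + a * W 0 x = a * v x - g (v x)"
    using periodic_fourth_order_solution[OF T q qa fc fT] by blast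
  obtain K1 where K1: "K1 > 0" and sup: "\<forall>Y e. periodic_chain T Y \<longrightarrow>
      (\<forall>x. \<bar>Y 4 x + q * Y 2 x + a * Y 0 x\<bar> \<le> e) \<longrightarrow> (\<forall>x. \<bar>Y 0 x\<bar> \<le> K1 * e)"
    using linear_equation_sup_bound[OF T qa] by blast
  define K2 where "K2 = K1 * (a + L)"
  have K2: "K2 > 0" using K1 a0 L0 by (simp add: K2_def)
  \<comment> \<open>The index \<open>Suc (k n)\<close> need not belong to the subsequence. Its
    iterate is compared with \<open>W\<close> through the linear equation, since
    \<open>V (k n)\<close> is close to \<open>v\<close>, and with \<open>V (k n)\<close> through
    \<delta>.\<close>
  have approx: "\<exists>n. (\<forall>x. \<bar>V (k n) 0 x - v x\<bar> \<le> e) \<and> (\<forall>x. \<bar>V (Suc (k n)) 0 x - W 0 x\<bar> \<le> K2 * e) \<and> \<delta> (k n) \<le> e"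
    if e: "e > 0" for e
  proof -
    obtain N where N: "\<And>n x. n \<ge> N \<Longrightarrow> \<bar>V (k n) 0 x - v x\<bar> < e" using conv e by blast
    have "(\<lambda>n. \<delta> (k n)) \<longlonglongrightarrow> 0" using LIMSEQ_subseq_LIMSEQ[OF \<delta>lim k] by (simp add: o_def)
    then have "\<forall>\<^sub>F n in sequentially. \<delta> (k n) < e" using e by (rule order_tendstoD)
    then obtain N' where "\<And>n. n \<ge> N' \<Longrightarrow> \<delta> (k n) < e" by (auto simp: eventually_sequentially)
    then obtain n where n: "n \<ge> N" "\<delta> (k n) < e" using max.cobounded1 max.cobounded2 by blast
    have close: "\<bar>V (k n) 0 x - v x\<bar> \<le> e" for x using N n(1) less_imp_le by blast
    have "\<bar>V (Suc (k n)) 0 x - W 0 x\<bar> \<le> K1 * ((a + L) * e)" for x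
    proof (rule sup[rule_format, of "\<lambda>j x. V (Suc (k n)) j x - W j x"])
      fix x
      have "(V (Suc (k n)) 4 x - W 4 x) + q * (V (Suc (k n)) 2 x - W 2 x) + a * (V (Suc (k n)) 0 x - W 0 x)
        = a * (V (k n) 0 x - v x) - (g (V (k n) 0 x) - g (v x))"
        using eq[of "k n" x] Weq[of x] by (simp add: algebra_simps)
      also have "\<bar>\<dots>\<bar> \<le> \<bar>a * (V (k n) 0 x - v x)\<bar> + \<bar>g (V (k n) 0 x) - g (v x)\<bar>"
        by (rule abs_triangle_ineq4)
      also have "\<dots> \<le> a * \<bar>V (k n) 0 x - v x\<bar> + L * \<bar>V (k n) 0 x - v x\<bar>"
        using L a0 by (simp add: abs_mult)
      also have "\<dots> \<le> a * e + L * e"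
        using close[of x] a0 L0 by (intro add_mono mult_left_mono) auto
      finally show "\<bar>(V (Suc (k n)) 4 x - W 4 x) + q * (V (Suc (k n)) 2 x - W 2 x)
          + a * (V (Suc (k n)) 0 x - W 0 x)\<bar> \<le> (a + L) * e"
        by (simp add: algebra_simps)
    qed (rule periodic_chain_diff[OF V W])
    then show ?thesis using close n(2) by (intro exI[of _ n]) (auto simp: K2_def mult.assoc)
  qed
  note WC = periodic_chain_continuous[OF W]
  have vC: "continuous_on S v" for S using vc continuous_on_subset by blast
  \<comment> \<open>Triangle inequality along \<open>W\<close>, \<open>V (Suc (k n))\<close>,
    \<open>V (k n)\<close>, \<open>v\<close>.\<close>
  have "?I (\<lambda>x. (W 0 x - v x)\<^sup>2) \<le> 0"
  proof (rule le_zero_if_le_small_multiples)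
    fix e :: real assume e: "0 < e" "e < 1"
    then obtain n where n: "\<And>x. \<bar>V (k n) 0 x - v x\<bar> \<le> e"
      "\<And>x. \<bar>V (Suc (k n)) 0 x - W 0 x\<bar> \<le> K2 * e" "\<delta> (k n) \<le> e"
      using approx by blast
    note VC = periodic_chain_continuous[OF V]
    have ee: "e\<^sup>2 \<le> e" using e by (simp add: power2_eq_square mult_left_le)
    have "?I (\<lambda>x. (W 0 x - v x)\<^sup>2) \<le> ?I (\<lambda>x. 3 * (K2\<^sup>2 + 1) * e + 3 * (V (Suc (k n)) 0 x - V (k n) 0 x)\<^sup>2)"
    proof (rule integral_real_mono)
      fix x
      have three: "(p + r + s)\<^sup>2 \<le> 3 * p\<^sup>2 + 3 * r\<^sup>2 + 3 * s\<^sup>2" for p r s :: real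
        using sum_squares_bound[of p r] sum_squares_bound[of p s] sum_squares_bound[of r s]
        by (simp add: power2_eq_square algebra_simps)
      have "(W 0 x - v x)\<^sup>2 = ((W 0 x - V (Suc (k n)) 0 x) + (V (Suc (k n)) 0 x - V (k n) 0 x) + (V (k n) 0 x - v x))\<^sup>2"
        by simp
      also have "\<dots> \<le> 3 * (W 0 x - V (Suc (k n)) 0 x)\<^sup>2 + 3 * (V (Suc (k n)) 0 x - V (k n) 0 x)\<^sup>2 + 3 * (V (k n) 0 x - v x)\<^sup>2"
        by (rule three)
      also have "\<dots> \<le> 3 * (K2 * e)\<^sup>2 + 3 * (V (Suc (k n)) 0 x - V (k n) 0 x)\<^sup>2 + 3 * e\<^sup>2"
        using n(1)[of x] n(2)[of x]
        by (intro add_mono mult_left_mono) (auto simp: abs_le_square_iff[symmetric] abs_minus_commute)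
      also have "\<dots> \<le> 3 * (K2\<^sup>2 + 1) * e + 3 * (V (Suc (k n)) 0 x - V (k n) 0 x)\<^sup>2"
        using ee mult_left_mono[OF ee, of "K2\<^sup>2"] by (simp add: power_mult_distrib algebra_simps)
      finally show "(W 0 x - v x)\<^sup>2 \<le> 3 * (K2\<^sup>2 + 1) * e + 3 * (V (Suc (k n)) 0 x - V (k n) 0 x)\<^sup>2" .
    qed (intro continuous_intros WC VC vC; simp)+
    also have "\<dots> = T * (3 * (K2\<^sup>2 + 1) * e) + 3 * \<delta> (k n)"
      unfolding \<delta>_def
      by (subst integral_add, (intro integrable_continuous_real continuous_intros VC; simp),
          (intro integrable_continuous_real continuous_intros VC; simp)) (use T in simp)
    also have "\<dots> \<le> (T * (3 * (K2\<^sup>2 + 1)) + 3) * e" using n(3) by (simp add: algebra_simps)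
    finally show "?I (\<lambda>x. (W 0 x - v x)\<^sup>2) \<le> (T * (3 * (K2\<^sup>2 + 1)) + 3) * e" .
  qed
  moreover have "?I (\<lambda>x. (W 0 x - v x)\<^sup>2) \<ge> 0"
    by (intro integral_nonneg integrable_continuous_real continuous_intros WC vC) auto
  ultimately have "?I (\<lambda>x. (W 0 x - v x)\<^sup>2) = 0" by simp
  moreover have "continuous_on {0..T} (\<lambda>x. (W 0 x - v x)\<^sup>2)" by (intro continuous_intros WC vC) simp
  ultimately have Wv0: "W 0 x = v x" if "x \<in> {0..T}" for x
    using that T integral_eq_0_iff[of 0 T "\<lambda>x. (W 0 x - v x)\<^sup>2"] by auto
  have Wv: "W 0 x = v x" for x
  proof -
    obtain y where y: "y \<in> {0..T}" and yf: "\<And>f :: real \<Rightarrow> real. (\<And>x. f (x + T) = f x) \<Longrightarrow> f x = f y"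
      using periodic_reduce[OF T] by blast
    have "W 0 x = W 0 y" "v x = v y" using periodic_chain_periodic[OF W, of 0] vT by (auto intro!: yf)
    then show ?thesis using Wv0[OF y] by simp
  qed
  have sol: "W 4 x + q * W 2 x + g (W 0 x) = 0" for x using Weq[of x] Wv[of x] by simp
  \<comment> \<open>The energy estimate is applied with an iterate as old point and \<open>W\<close>
    as new one. As \<open>W\<close> solves the equation, the bound is quadratic in their sup
    distance, so uniform convergence of the functions alone suffices.\<close>
  have "?E W - ?E U \<le> 0"
  proof (rule le_zero_if_le_small_multiples)
    fix e :: real assume e: "0 < e" "e < 1"
    then obtain n where n: "\<And>x. \<bar>V (Suc (k n)) 0 x - W 0 x\<bar> \<le> K2 * e"
      using approx by blast
    let ?V = "V (Suc (k n))"
    note VC = periodic_chain_continuous[OF V]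
    have gC: "continuous_on {0..T} (\<lambda>x. g (?V 0 x))"
      by (rule continuous_on_compose2[OF gc]; use VC in simp)
    have ee: "e\<^sup>2 \<le> e" using e by (simp add: power2_eq_square mult_left_le)
    have "?E W - ?E ?V \<le> ?I (\<lambda>x. (W 4 x + q * W 2 x + g (?V 0 x)) * (W 0 x - ?V 0 x)
      + (L + q\<^sup>2 / 8) * (W 0 x - ?V 0 x)\<^sup>2)"
      by (rule energy_diff_le[OF T V W G L])
    also have "\<dots> \<le> ?I (\<lambda>x. (2 * L + q\<^sup>2 / 8) * K2\<^sup>2 * e)"
    proof (rule integral_real_mono)
      fix x
      have "W 4 x + q * W 2 x + g (?V 0 x) = g (?V 0 x) - g (W 0 x)" using sol[of x] by simp
      then have "(W 4 x + q * W 2 x + g (?V 0 x)) * (W 0 x - ?V 0 x) \<le> \<bar>g (?V 0 x) - g (W 0 x)\<bar> * \<bar>W 0 x - ?V 0 x\<bar>"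
        by (simp add: abs_mult[symmetric])
      also have "\<dots> \<le> L * \<bar>?V 0 x - W 0 x\<bar> * \<bar>W 0 x - ?V 0 x\<bar>"
        by (intro mult_right_mono L) simp
      also have "\<dots> = L * (W 0 x - ?V 0 x)\<^sup>2"
        by (simp add: abs_minus_commute power2_eq_square mult.assoc)
      finally have "(W 4 x + q * W 2 x + g (?V 0 x)) * (W 0 x - ?V 0 x) + (L + q\<^sup>2 / 8) * (W 0 x - ?V 0 x)\<^sup>2
        \<le> (2 * L + q\<^sup>2 / 8) * (W 0 x - ?V 0 x)\<^sup>2"
        by (simp add: algebra_simps)
      also have "\<dots> \<le> (2 * L + q\<^sup>2 / 8) * (K2 * e)\<^sup>2"
        using n[of x] L0
        by (intro mult_left_mono) (auto simp: abs_le_square_iff[symmetric] abs_minus_commute)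
      also have "\<dots> \<le> (2 * L + q\<^sup>2 / 8) * (K2\<^sup>2 * e)"
        using L0 ee by (intro mult_left_mono) (auto simp: power_mult_distrib intro!: mult_left_mono)
      finally show "(W 4 x + q * W 2 x + g (?V 0 x)) * (W 0 x - ?V 0 x) + (L + q\<^sup>2 / 8) * (W 0 x - ?V 0 x)\<^sup>2
        \<le> (2 * L + q\<^sup>2 / 8) * K2\<^sup>2 * e"
        by (simp add: mult.assoc)
    qed (intro continuous_intros WC VC gC; simp)+
    also have "\<dots> = T * (2 * L + q\<^sup>2 / 8) * K2\<^sup>2 * e" using T by simp
    finally show "?E W - ?E U \<le> T * (2 * L + q\<^sup>2 / 8) * K2\<^sup>2 * e"
      using EU[of "Suc (k n)"] by simp
  qed
  then show ?thesis using that W sol by simp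
qed

section \<open>Quadratic extension of the potential outside an interval\<close>

lemma eq_if_same_derivative:
  fixes f g h :: "real \<Rightarrow> real"
  assumes "convex S" and "\<And>x. x \<in> S \<Longrightarrow> (f has_real_derivative h x) (at x)"
    and "\<And>x. x \<in> S \<Longrightarrow> (g has_real_derivative h x) (at x)"
    and "a \<in> S" and "f a = g a" and "x \<in> S"
  shows "f x = g x"
proof -
  have "((\<lambda>x. f x - g x) has_field_derivative 0) (at x within S)" if "x \<in> S" for x
    using DERIV_diff[OF assms(2,3)] that by (auto intro: has_field_derivative_at_within)
  then obtain c where "\<And>x. x \<in> S \<Longrightarrow> f x - g x = c"
    using has_field_derivative_zero_constant[OF assms(1), of "\<lambda>x. f x - g x"] by blast
  from this[of a] this[of x] show ?thesis using assms by simp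
qed

text \<open>The quadratic coefficient \<open>K\<close> of the extension is chosen large enough that, at the cost of
  replacing \<open>b\<close> by \<open>b + 1\<close>, the lower bound survives whatever the slopes at \<open>M\<close> and \<open>-M\<close> are.
  It is important that the new lower bound does not depend on \<open>M\<close>.\<close>

lemma quadratic_extension:
  fixes F f :: "real \<Rightarrow> real"
  assumes M: "M > 0" and F: "\<And>t. (F has_real_derivative f t) (at t)"
    and fL: "\<And>s t. s \<in> {-M..M} \<Longrightarrow> t \<in> {-M..M} \<Longrightarrow> \<bar>f s - f t\<bar> \<le> L * \<bar>s - t\<bar>"
    and Fb: "\<And>t. c * t\<^sup>2 - b \<le> F t"
  obtains G g L' where "\<And>t. (G has_real_derivative g t) (at t)"
    and "\<And>s t. \<bar>g s - g t\<bar> \<le> L' * \<bar>s - t\<bar>"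
    and "\<And>t. t \<in> {-M..M} \<Longrightarrow> G t = F t" and "\<And>t. t \<in> {-M..M} \<Longrightarrow> g t = f t"
    and "\<And>t. c * t\<^sup>2 - (b + 1) \<le> G t"
proof -
  \<comment> \<open>\<open>A\<close> and \<open>B\<close> are the slopes of
    \<open>F t - c * t\<^sup>2\<close> at \<open>M\<close> and \<open>- M\<close>.\<close>
  define A where "A = f M - 2 * c * M"
  define B where "B = f (- M) + 2 * c * M"
  define K where "K = \<bar>c\<bar> + A\<^sup>2 / 4 + B\<^sup>2 / 4"
  have K0: "K \<ge> 0" by (simp add: K_def)
  have "0 \<le> A\<^sup>2 / 4" and "0 \<le> B\<^sup>2 / 4" by simp_all
  then have KA: "c + A\<^sup>2 / 4 \<le> K" and KB: "c + B\<^sup>2 / 4 \<le> K"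
    using abs_ge_self[of c] unfolding K_def by linarith+
  \<comment> \<open>Clamping to \<open>[-M, M]\<close>. Both \<theta> and its difference from the
    identity are 1-Lipschitz, so the single formula for \<open>g\<close> handles all three regions
    at once.\<close>
  define \<theta> where "\<theta> t = max (- M) (min M t)" for t
  have \<theta>: "\<theta> t \<in> {-M..M}" for t using M by (auto simp: \<theta>_def)
  have \<theta>1: "\<bar>\<theta> s - \<theta> t\<bar> \<le> \<bar>s - t\<bar>" and \<theta>2: "\<bar>(s - \<theta> s) - (t - \<theta> t)\<bar> \<le> \<bar>s - t\<bar>" for s t
    using M by (auto simp: \<theta>_def max_def min_def)
  define g where "g t = f (\<theta> t) + 2 * K * (t - \<theta> t)" for t
  have L0: "L \<ge> 0" using fL[of 0 M] M by (auto simp: zero_le_mult_iff dest: order_trans[OF abs_ge_zero])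
  have gL: "\<bar>g s - g t\<bar> \<le> (L + 2 * K) * \<bar>s - t\<bar>" for s t
  proof -
    have "g s - g t = (f (\<theta> s) - f (\<theta> t)) + 2 * K * ((s - \<theta> s) - (t - \<theta> t))"
      by (simp add: g_def algebra_simps)
    also have "\<bar>\<dots>\<bar> \<le> \<bar>f (\<theta> s) - f (\<theta> t)\<bar> + \<bar>2 * K * ((s - \<theta> s) - (t - \<theta> t))\<bar>"
      by (rule abs_triangle_ineq)
    also have "\<dots> \<le> L * \<bar>\<theta> s - \<theta> t\<bar> + 2 * K * \<bar>(s - \<theta> s) - (t - \<theta> t)\<bar>"
      using fL[OF \<theta> \<theta>, of s t] K0 by (simp add: abs_mult)
    also have "\<dots> \<le> L * \<bar>s - t\<bar> + 2 * K * \<bar>s - t\<bar>"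
      using \<theta>1 \<theta>2 L0 K0 by (intro add_mono mult_left_mono) auto
    finally show ?thesis by (simp add: algebra_simps)
  qed
  have gc: "continuous_on UNIV g" using gL by (rule lipschitz_imp_continuous)
  have "\<exists>H. \<forall>x::real. - \<infinity> < ereal x \<longrightarrow> ereal x < \<infinity> \<longrightarrow> (H has_vector_derivative g x) (at x)"
    by (rule einterval_antiderivative) (use gc in \<open>auto simp: continuous_on_eq_continuous_at\<close>)
  then obtain H where H: "\<And>x::real. (H has_real_derivative g x) (at x)"
    by (auto simp: has_real_derivative_iff_has_vector_derivative)
  define G where "G t = H t + (F 0 - H 0)" for t
  have G: "(G has_real_derivative g t) (at t)" for t
    unfolding G_def[abs_def] by (auto intro!: derivative_eq_intros H)
  have g_in: "g t = f t" if "t \<in> {-M..M}" for t using that by (auto simp: g_def \<theta>_def)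
  have G_in: "G t = F t" if "t \<in> {-M..M}" for t
    by (rule eq_if_same_derivative[of "{-M..M}" G f F 0])
      (use F that M in \<open>auto simp: G_def[of 0] intro: DERIV_cong[OF G g_in]\<close>)
  have G_right: "G t = F M + f M * (t - M) + K * (t - M)\<^sup>2" if "t \<ge> M" for t
  proof (rule eq_if_same_derivative[of "{M..}" G g _ M])
    show "((\<lambda>t. F M + f M * (t - M) + K * (t - M)\<^sup>2) has_real_derivative g t) (at t)" if "t \<in> {M..}" for t
      using that M by (auto intro!: derivative_eq_intros simp: g_def \<theta>_def)
  qed (use that M G G_in[of M] in auto)
  have G_left: "G t = F (-M) + f (-M) * (t + M) + K * (t + M)\<^sup>2" if "t \<le> - M" for t
  proof (rule eq_if_same_derivative[of "{..-M}" G g _ "-M"])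
    show "((\<lambda>t. F (-M) + f (-M) * (t + M) + K * (t + M)\<^sup>2) has_real_derivative g t) (at t)" if "t \<in> {..-M}" for t
      using that M by (auto intro!: derivative_eq_intros simp: g_def \<theta>_def max_def min_def)
  qed (use that M G G_in[of "-M"] in auto)
  have "c * t\<^sup>2 - (b + 1) \<le> G t" for t
  proof -
    consider "t \<in> {-M..M}" | "t \<ge> M" | "t \<le> - M" by fastforce
    then show ?thesis
    proof cases
      case 1
      then show ?thesis using G_in[OF 1] Fb[of t] by simp
    next
      case 2
      \<comment> \<open>Expanded about \<open>M\<close>, \<open>G t - c * t\<^sup>2\<close> has
        slope \<open>A\<close> and leading coefficient \<open>K - c\<close>; the square shows that
        it falls at most 1 below its value at \<open>M\<close>.\<close>
      have "0 \<le> (A * (t - M) / 2 + 1)\<^sup>2" by simp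
      also have "\<dots> = A\<^sup>2 / 4 * (t - M)\<^sup>2 + A * (t - M) + 1" by (simp add: power2_eq_square field_simps)
      also have "\<dots> \<le> (K - c) * (t - M)\<^sup>2 + A * (t - M) + 1"
        using KA mult_right_mono[of "A\<^sup>2 / 4" "K - c" "(t - M)\<^sup>2"] by simp
      finally have "0 \<le> K * (t - M)\<^sup>2 + f M * (t - M) + 1 + c * M\<^sup>2 - c * t\<^sup>2"
        by (simp add: A_def power2_eq_square algebra_simps)
      then show ?thesis using G_right[OF 2] Fb[of M] by simp
    next
      case 3
      have "0 \<le> (B * (t + M) / 2 + 1)\<^sup>2" by simp
      also have "\<dots> = B\<^sup>2 / 4 * (t + M)\<^sup>2 + B * (t + M) + 1" by (simp add: power2_eq_square field_simps)
      also have "\<dots> \<le> (K - c) * (t + M)\<^sup>2 + B * (t + M) + 1"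
        using KB mult_right_mono[of "B\<^sup>2 / 4" "K - c" "(t + M)\<^sup>2"] by simp
      finally have "0 \<le> K * (t + M)\<^sup>2 + f (-M) * (t + M) + 1 + c * M\<^sup>2 - c * t\<^sup>2"
        by (simp add: B_def power2_eq_square algebra_simps)
      then show ?thesis using G_left[OF 3] Fb[of "-M"] by simp
    qed
  qed
  then show ?thesis using that[OF G gL G_in g_in] by blast
qed

section \<open>A test function of negative energy\<close>

text \<open>At the minimum \<open>f 0 = 0\<close>, so the derivative \<open>2 * m * t - f t\<close>
  of \<open>m * t\<^sup>2 - F t\<close> vanishes at 0 with positive slope \<open>2 * m - d\<close>.
  Hence it has the sign of \<open>t\<close> near 0, and the difference has a local minimum
  there.\<close>

lemma quadratic_upper_bound_at_min:
  fixes F f :: "real \<Rightarrow> real"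
  assumes F: "\<And>t. (F has_real_derivative f t) (at t)" and f: "(f has_real_derivative d) (at 0)"
    and "F 0 = 0" and "\<And>t. F 0 \<le> F t" and d: "d < 2 * m"
  obtains r where "r > 0" and "\<And>t. \<bar>t\<bar> \<le> r \<Longrightarrow> F t \<le> m * t\<^sup>2"
proof -
  have f0: "f 0 = 0" using DERIV_local_min[OF F, of 1 0] assms(4) by simp
  have h: "((\<lambda>t. m * t\<^sup>2 - F t) has_real_derivative 2 * m * t - f t) (at t)" for t
    by (auto intro!: derivative_eq_intros F)
  have h': "((\<lambda>t. 2 * m * t - f t) has_real_derivative 2 * m - d) (at 0)"
    by (auto intro!: derivative_eq_intros f)
  obtain r1 where r1: "r1 > 0" "\<And>t. 0 < t \<Longrightarrow> t < r1 \<Longrightarrow> 0 < 2 * m * t - f t"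
    using DERIV_pos_inc_right[OF h'] d f0 by auto
  obtain r2 where r2: "r2 > 0" "\<And>t. 0 < t \<Longrightarrow> t < r2 \<Longrightarrow> 2 * m * (- t) - f (- t) < 0"
    using DERIV_pos_inc_left[OF h'] d f0 by auto
  show ?thesis
  proof (rule that[of "min r1 r2 / 2"])
    show "min r1 r2 / 2 > 0" using r1 r2 by simp
    fix t assume t: "\<bar>t\<bar> \<le> min r1 r2 / 2"
    then have tr: "\<bar>t\<bar> < r1" "\<bar>t\<bar> < r2" using r1(1) r2(1) by auto
    consider "t = 0" | "t > 0" | "t < 0" by linarith
    then show "F t \<le> m * t\<^sup>2"
    proof cases
      case 1
      then show ?thesis using assms(3) by simp
    next
      case 2
      from MVT2[OF 2, OF h] obtain z where "0 < z" "z < t"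
        "m * t\<^sup>2 - F t - (m * 0\<^sup>2 - F 0) = (t - 0) * (2 * m * z - f z)" by blast
      moreover from this have "0 < 2 * m * z - f z" using r1(2)[of z] tr 2 by simp
      then have "0 < (t - 0) * (2 * m * z - f z)" using 2 by simp
      ultimately show ?thesis using assms(3) by simp
    next
      case 3
      from MVT2[OF 3, OF h] obtain z where "t < z" "z < 0"
        "m * 0\<^sup>2 - F 0 - (m * t\<^sup>2 - F t) = (0 - t) * (2 * m * z - f z)" by blast
      moreover from this have "2 * m * z - f z < 0" using r2(2)[of "- z"] tr 3 by simp
      then have "(0 - t) * (2 * m * z - f z) < 0" using 3 by (intro mult_pos_neg) auto
      ultimately show ?thesis using assms(3) by simp
    qed
  qed
qed

text \<open>For \<open>e * cos (w * x)\<close> with \<open>w\<^sup>2 = q / 2\<close> the quadratic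
  part of the energy equals \<open>- e\<^sup>2 * q\<^sup>2 * T / 16\<close>, while \<open>G\<close>
  adds at most \<open>m * e\<^sup>2 * T / 2\<close>.\<close>

lemma cosine_energy_negative:
  fixes q m e :: real
  assumes q: "q > 0" and e: "e > 0" and m: "m < q\<^sup>2 / 8"
    and G: "continuous_on UNIV G" and Gm: "\<And>t. \<bar>t\<bar> \<le> e \<Longrightarrow> G t \<le> m * t\<^sup>2"
    and w: "w = sqrt (q / 2)" and T: "T = 2 * pi / w"
  obtains U where "periodic_chain T U" and "energy T q G U < 0"
proof -
  have w0: "w > 0" and w2: "w\<^sup>2 = q / 2" using q by (simp_all add: w)
  have T0: "T > 0" and wT: "w * T = 2 * pi" using w0 by (simp_all add: T)
  define U where "U = (\<lambda>(j::nat) x. if j = 0 then e * cos (w * x) else if j = 1 then - e * w * sin (w * x)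
    else if j = 2 then - e * w ^ 2 * cos (w * x) else if j = 3 then e * w ^ 3 * sin (w * x)
    else e * w ^ 4 * cos (w * x))"
  have U: "U 0 = (\<lambda>x. e * cos (w * x))" "U 1 = (\<lambda>x. - e * w * sin (w * x))"
    "U 2 = (\<lambda>x. - e * w ^ 2 * cos (w * x))" "U 3 = (\<lambda>x. e * w ^ 3 * sin (w * x))"
    "U 4 = (\<lambda>x. e * w ^ 4 * cos (w * x))" by (simp_all add: U_def)
  have chain: "periodic_chain T U"
    by (rule periodic_chainI; unfold U)
      (auto intro!: derivative_eq_intros continuous_intros simp: wT distrib_left eval_nat_numeral)
  let ?I = "integral {0..T}"
  let ?C = "?I (\<lambda>x. (cos (w * x))\<^sup>2)" and ?S = "?I (\<lambda>x. (sin (w * x))\<^sup>2)"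
  \<comment> \<open>Integration by parts equates the integrals of the squared cosine and sine; as
    they sum to \<open>T\<close>, each is \<open>T / 2\<close>.\<close>
  have "?I (\<lambda>x. (w * cos (w * x)) * cos (w * x)) = - ?I (\<lambda>x. sin (w * x) * (- (w * sin (w * x))))"
    by (rule integral_by_parts_periodic[OF T0])
      (auto intro!: derivative_eq_intros continuous_intros simp: wT)
  then have CS: "?C = ?S" using w0 by (simp add: power2_eq_square mult.assoc mult.left_commute)
  have "?C + ?S = ?I (\<lambda>x. (cos (w * x))\<^sup>2 + (sin (w * x))\<^sup>2)"
    by (intro integral_add[symmetric] integrable_continuous_real continuous_intros)
  also have "\<dots> = T" using T0 by simp
  finally have C: "?C = T / 2" and S: "?S = T / 2" using CS by simp_all
  have GC: "continuous_on {0..T} (\<lambda>x. G (e * cos (w * x)))"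
    by (rule continuous_on_compose2[OF G]) (auto intro!: continuous_intros)
  have "energy T q G U \<le> ?I (\<lambda>x. e\<^sup>2 * (q\<^sup>2 / 8 + m) * (cos (w * x))\<^sup>2 + (- (e\<^sup>2 * q\<^sup>2 / 4)) * (sin (w * x))\<^sup>2)"
    unfolding energy_def U
  proof (rule integral_real_mono)
    fix x
    have "\<bar>e * cos (w * x)\<bar> \<le> e" using e by (simp add: abs_mult mult_left_le)
    from Gm[OF this] have "G (e * cos (w * x)) \<le> m * e\<^sup>2 * (cos (w * x))\<^sup>2"
      by (simp add: power_mult_distrib mult.assoc)
    moreover have "(- e * w\<^sup>2 * cos (w * x))\<^sup>2 / 2 - q / 2 * (- e * w * sin (w * x))\<^sup>2
      = e\<^sup>2 * (q\<^sup>2 / 8) * (cos (w * x))\<^sup>2 - e\<^sup>2 * q\<^sup>2 / 4 * (sin (w * x))\<^sup>2"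
      unfolding power_mult_distrib w2 by (simp add: power2_eq_square)
    ultimately show "(- e * w\<^sup>2 * cos (w * x))\<^sup>2 / 2 - q / 2 * (- e * w * sin (w * x))\<^sup>2 + G (e * cos (w * x))
      \<le> e\<^sup>2 * (q\<^sup>2 / 8 + m) * (cos (w * x))\<^sup>2 + (- (e\<^sup>2 * q\<^sup>2 / 4)) * (sin (w * x))\<^sup>2"
      by (simp add: algebra_simps)
  qed (intro continuous_intros GC; simp)+
  also have "\<dots> = e\<^sup>2 * (q\<^sup>2 / 8 + m) * ?C + (- (e\<^sup>2 * q\<^sup>2 / 4)) * ?S"
    by (subst integral_add, (intro integrable_continuous_real continuous_intros),
        (intro integrable_continuous_real continuous_intros)) simp
  also have "\<dots> = e\<^sup>2 * T / 2 * (m - q\<^sup>2 / 8)" unfolding C S by (simp add: field_simps)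
  also have "\<dots> < 0" using e T0 m by (intro mult_pos_neg) auto
  finally show ?thesis using that[OF chain] by blast
qed

section \<open>From chains to solutions, and the existence theorem\<close>

lemma periodic_chain_C_4:
  assumes "periodic_chain T U"
  shows "C_k 4 (U 0)" and "(deriv ^^ 2) (U 0) = U 2" and "(deriv ^^ 4) (U 0) = U 4"
proof -
  have D: "(U j has_real_derivative U (Suc j) x) (at x)" if "j < 4" for j x
    using assms that by (simp add: periodic_chain_def)
  have it: "(deriv ^^ j) (U 0) = U j" if "j \<le> 4" for j
    using that
  proof (induction j)
    case (Suc j)
    then have "(deriv ^^ j) (U 0) = U j" by simp
    then show ?case using D[of j] Suc.prems by (auto intro!: ext DERIV_imp_deriv)
  qed simp
  show "(deriv ^^ 2) (U 0) = U 2" and "(deriv ^^ 4) (U 0) = U 4" by (simp_all add: it)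
  show "C_k 4 (U 0)"
    unfolding C_k_def
  proof (intro conjI allI impI)
    show "(deriv ^^ j) (U 0) differentiable (at x)" if "j < 4" for j x
      using D[OF that] it[of j] that unfolding real_differentiable_def by auto
    show "continuous_on UNIV ((deriv ^^ 4) (U 0))"
      using periodic_chain_continuous[OF assms] by (simp add: it)
  qed
qed

theorem theorem1p11:
  fixes F :: "real \<Rightarrow> real" and q :: real
  assumes "C_k 2 F"
    and "F 0 = 0"
    and "\<forall>t. F 0 \<le> F t"
    and "q > 0"
    and "4 * (deriv ^^ 2) F 0 < q\<^sup>2"
    and "ereal (q\<^sup>2) < 2 * Liminf at_infinity (\<lambda>t::real. ereal (F t / t\<^sup>2))"
  shows "\<exists>u. is_solution F q u \<and> nontrivial u \<and> periodic u"
proof -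
  define f where "f = deriv F"
  define f2 where "f2 = deriv f"
  have diff: "(deriv ^^ j) F differentiable (at x)" if "j < 2" for j x
    using assms(1) that by (simp add: C_k_def)
  have F: "(F has_real_derivative f x) (at x)" for x
    using diff[of 0 x] by (simp add: f_def DERIV_deriv_iff_real_differentiable)
  have f: "(f has_real_derivative f2 x) (at x)" for x
    using diff[of 1 x] by (simp add: f_def f2_def DERIV_deriv_iff_real_differentiable)
  have it2: "(deriv ^^ 2) F = f2" by (simp add: f_def f2_def numeral_2_eq_2)
  have f2c: "continuous_on UNIV f2" using assms(1) by (simp add: C_k_def it2)
  have F_nonneg: "F t \<ge> 0" for t using assms(2,3) by simp

  define c where "c = q\<^sup>2 / 2"
  have qc: "q\<^sup>2 < 8 * c" using assms(4) by (simp add: c_def)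
  \<comment> \<open>The case split on \<open>ereal\<close> includes an infinite liminf.\<close>
  have "ereal c < Liminf at_infinity (\<lambda>t::real. ereal (F t / t\<^sup>2))"
    using assms(6) by (cases "Liminf at_infinity (\<lambda>t::real. ereal (F t / t\<^sup>2))") (auto simp: c_def)
  then have "\<forall>\<^sub>F t in at_infinity. c < F t / t\<^sup>2" by (auto dest: less_LiminfD)
  then obtain R where R: "\<And>t. R \<le> \<bar>t\<bar> \<Longrightarrow> c < F t / t\<^sup>2"
    by (auto simp: eventually_at_infinity)
  define b where "b = c * R\<^sup>2"
  have c0: "c > 0" using assms(4) by (simp add: c_def)
  then have b0: "b \<ge> 0" by (simp add: b_def)
  have Fb: "c * t\<^sup>2 - b \<le> F t" for t
  proof (cases "R \<le> \<bar>t\<bar>")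
    case True
    \<comment> \<open>\<open>R\<close> may be nonpositive. At \<open>t = 0\<close> the quotient is 0
      by the convention on division, which contradicts \<open>c > 0\<close>.\<close>
    have "t \<noteq> 0" using R[OF True] c0 by auto
    then have "c * t\<^sup>2 \<le> F t" using R[OF True] by (simp add: field_simps)
    then show ?thesis using b0 by simp
  next
    case False
    then have "\<bar>t\<bar> \<le> \<bar>R\<bar>" by simp
    then have "t\<^sup>2 \<le> R\<^sup>2" by (simp add: abs_le_square_iff)
    then have "c * t\<^sup>2 \<le> b" using c0 by (simp add: b_def)
    then show ?thesis using F_nonneg[of t] by simp
  qed

  define w where "w = sqrt (q / 2)"
  define T where "T = 2 * pi / w"
  have T: "T > 0" using assms(4) by (simp add: T_def w_def)
  obtain K where K: "K > 0" and coer: "\<forall>U G b. periodic_chain T U \<longrightarrow> continuous_on UNIV G \<longrightarrow>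
      (\<forall>t. c * t\<^sup>2 - b \<le> G t) \<longrightarrow>
      integral {0..T} (\<lambda>x. (U 0 x)\<^sup>2 + (U 2 x)\<^sup>2) \<le> K * (energy T q G U + b * T)"
    using energy_coercive[OF T qc] by blast
  \<comment> \<open>The sup bound for functions of negative energy, computed with
    \<open>b + 1\<close> because this is the constant in the lower bound of the extension still to
    be built. The final summand makes \<open>M\<close> positive.\<close>
  define M where "M = sqrt ((1 / T + 2) * (K * ((b + 1) * T))) + 1"
  have M: "M > 0" using T K b0 by (auto simp: M_def intro!: add_nonneg_pos)

  have "bounded (f2 ` {-M..M})"
    by (intro compact_imp_bounded compact_continuous_image continuous_on_subset[OF f2c]) auto
  then obtain L where L: "\<forall>t\<in>{-M..M}. \<bar>f2 t\<bar> \<le> L" by (auto simp: bounded_iff)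
  have fL: "\<bar>f s - f t\<bar> \<le> L * \<bar>s - t\<bar>" if "s \<in> {-M..M}" "t \<in> {-M..M}" for s t
    using field_differentiable_bound[of "{-M..M}" f f2 L s t] that L f
    by (auto intro: has_field_derivative_at_within)
  obtain G g L' where G: "\<And>t. (G has_real_derivative g t) (at t)"
    and gL: "\<And>s t. \<bar>g s - g t\<bar> \<le> L' * \<bar>s - t\<bar>"
    and GF: "\<And>t. t \<in> {-M..M} \<Longrightarrow> G t = F t" and gf: "\<And>t. t \<in> {-M..M} \<Longrightarrow> g t = f t"
    and Gb: "\<And>t. c * t\<^sup>2 - (b + 1) \<le> G t"
    using quadratic_extension[of M F f L c b] M F fL Fb by metis
  have Gc: "continuous_on UNIV G" using G by (rule has_real_derivative_imp_continuous_on)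

  \<comment> \<open>The midpoint of \<open>f2 0 / 2\<close> and \<open>q\<^sup>2 / 8\<close>, which
    are strictly ordered by the hypothesis on \<open>F''(0)\<close>.\<close>
  define m where "m = (f2 0 / 2 + q\<^sup>2 / 8) / 2"
  have m: "f2 0 < 2 * m" "m < q\<^sup>2 / 8" using assms(5) by (simp_all add: m_def it2)
  obtain r where r: "r > 0" "\<And>t. \<bar>t\<bar> \<le> r \<Longrightarrow> F t \<le> m * t\<^sup>2"
    using quadratic_upper_bound_at_min[of F f "f2 0" m] F f assms(2,3) m(1) by metis
  \<comment> \<open>An amplitude at which the quadratic bound holds and \<open>G\<close> still
    agrees with \<open>F\<close>.\<close>
  define e where "e = min r M"
  have Gm: "G t \<le> m * t\<^sup>2" if "\<bar>t\<bar> \<le> e" for t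
    using that r(2)[of t] GF[of t] by (auto simp: e_def abs_le_iff)
  have e0: "e > 0" using r M by (simp add: e_def)
  obtain U where U: "periodic_chain T U" and EU: "energy T q G U < 0"
    using cosine_energy_negative[OF assms(4) e0 m(2) Gc Gm w_def T_def] by blast
  obtain W where W: "periodic_chain T W" and sol: "\<And>x. W 4 x + q * W 2 x + g (W 0 x) = 0"
    and EW: "energy T q G W \<le> energy T q G U"
    by (rule periodic_solution_below_energy[OF T assms(4) qc U G gL Gb]) blast
  \<comment> \<open>Negative energy confines \<open>W 0\<close> to \<open>[-M, M]\<close>, where
    \<open>g = f\<close>; hence the modified equation is the original one.\<close>
  have WM: "W 0 x \<in> {-M..M}" for x
  proof -
    have "integral {0..T} (\<lambda>x. (W 0 x)\<^sup>2 + (W 2 x)\<^sup>2) \<le> K * (energy T q G W + (b + 1) * T)"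
      using coer W Gc Gb by blast
    also have "\<dots> \<le> K * ((b + 1) * T)" using EW EU K by (intro mult_left_mono) auto
    finally have N: "integral {0..T} (\<lambda>x. (W 0 x)\<^sup>2 + (W 2 x)\<^sup>2) \<le> K * ((b + 1) * T)" .
    have "(W 0 x)\<^sup>2 \<le> (1 / T + 2) * integral {0..T} (\<lambda>x. (W 0 x)\<^sup>2 + (W 2 x)\<^sup>2)"
      by (rule periodic_chain_sup_bound(1)[OF T W])
    also have "\<dots> \<le> (1 / T + 2) * (K * ((b + 1) * T))" using N T by (intro mult_left_mono) auto
    finally have "\<bar>W 0 x\<bar> \<le> sqrt ((1 / T + 2) * (K * ((b + 1) * T)))"
      by (metis real_sqrt_abs real_sqrt_le_iff)
    then show ?thesis by (auto simp: M_def)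
  qed
  have "is_solution F q (W 0)"
    using sol gf[OF WM] periodic_chain_C_4[OF W] by (simp add: is_solution_def f_def)
  moreover have "nontrivial (W 0)"
    unfolding nontrivial_def
  proof
    assume "W 0 constant_on UNIV"
    then obtain k where k: "\<And>x. W 0 x = k" by (auto simp: constant_on_def)
    note D = periodic_chain_deriv[OF W]
    have W0: "W 0 = (\<lambda>x. k)" using k by auto
    have W1: "W 1 = (\<lambda>x. 0)"
      using D(1) DERIV_const unfolding W0 by (metis DERIV_unique ext)
    have W2: "W 2 = (\<lambda>x. 0)"
      using D(2) DERIV_const unfolding W1 by (metis DERIV_unique ext)
    have "energy T q G W = T * F k"
      using T GF[OF WM, of 0] unfolding energy_def W0 W1 W2 by simp
    then have "energy T q G W \<ge> 0" using T F_nonneg[of k] by simp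
    then show False using EW EU by simp
  qed
  moreover have "periodic (W 0)"
    unfolding periodic_def
    by (intro exI[of _ T] conjI T, unfold_locales) (use periodic_chain_periodic[OF W, of 0] in simp)
  ultimately show ?thesis by blast
qed

end
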